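(* Let $n\ge1$ and let $\pi$ be a $B_n$-partition consisting of a zero-block of half-size $i_0$ (allowing $i_0=0$, meaning that $\pi$ has no zero-block) and $k\ge1$ block pairs of sizes $i_1,i_2,\ldots,i_k$, listed in any order. Let $l$ be an integer with $l\ge1$ and $l\ge i_0$. Then the number $N^B(\pi;l)$ of $B_n$-partitions $\pi'$ containing exactly $l$ block pairs (and possibly a zero-block) that intersect $\pi$ minimally equals \[ N^B(\pi;l)=\frac{\mathbf{i}!}{(2l-2i_0)!!}\sum_{\mathbf{i}'}\left[\mathbf{x}^{\mathbf{i}'}\right]\left(\prod_{\alpha=1}^{k}(1+x_\alpha)^2-1\right)^{l-i_0}\prod_{\alpha=1}^{k}(1+x_\alpha)^{2i_0}, \] where $\mathbf{i}!=\prod_{\alpha=1}^k i_\alpha!$, the sum runs over all vectors $\mathbf{i}'=(i_1',\ldots,i_k')$ with $i_\alpha'\in\{i_\alpha,i_\alpha-1\}$ for every $\alpha\in\{1,\ldots,k\}$, and $\mathbf{x}^{\mathbf{i}'}=\prod_{\alpha=1}^k x_\alpha^{i_\alpha'}$.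
   Context: Let $[\pm n]=\{\pm1,\ldots,\pm n\}$. A $B_n$-partition (set partition of type $B_n$) is a partition of $[\pm n]$ into blocks such that (i) for every block $B$, its negative $-B=\{-b:b\in B\}$ is also a block, and (ii) there is at most one block $B$ with $B=-B$, called the zero-block. If the zero-block is $\{\pm j_1,\ldots,\pm j_m\}$, it has half-size $m$. For a non-zero-block $B$, the pair $\{B,-B\}$ is called a block pair, and its size is $|B|$. $B_n$-partitions are ordered by refinement; the meet $\pi\wedge\pi'$ is the coarsest common refinement, whose blocks are the nonempty intersections $B\cap B'$ of a block $B$ of $\pi$ and a block $B'$ of $\pi'$. The minimal element is $\hat0^B=\{\{1\},\{-1\},\ldots,\{n\},\{-n\}\}$. Partitions $\pi_1,\ldots,\pi_r$ intersect minimally if $\pi_1\wedge\cdots\wedge\pi_r=\hat0^B$. The double factorial is $(2m)!!=2\cdot4\cdots(2m)=2^m m!$, with $0!!=1$. $[\mathbf{x}^{\mathbf{a}}]G$ denotes the coefficient of the monomial $\mathbf{x}^{\mathbf{a}}$ in the power series $G$ (zero if some exponent is negative). *)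

theory Defs
  imports Complex_Main "HOL-Library.Disjoint_Sets" "HOL-Library.Poly_Mapping"
begin

definition pm :: "nat \<Rightarrow> int set" where
  "pm n = {j. 1 \<le> \<bar>j\<bar> \<and> \<bar>j\<bar> \<le> int n}"

text \<open>Note that \<open>uminus ` B\<close> is \<open>{-b | b \<in> B}\<close>, whereas \<open>- B\<close> would be the set complement.\<close>

definition Bn_partition :: "nat \<Rightarrow> int set set \<Rightarrow> bool" where
  "Bn_partition n P \<longleftrightarrow>
     partition_on (pm n) P \<and>
     (\<forall>B\<in>P. uminus ` B \<in> P) \<and>
     (\<forall>B\<in>P. \<forall>C\<in>P. uminus ` B = B \<longrightarrow> uminus ` C = C \<longrightarrow> B = C)"

text \<open>The zero-block \<open>{\<plusminus>j\<^sub>1, \<dots>, \<plusminus>j\<^sub>m}\<close> has \<open>m\<close> distinct absolute values. The union below is the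
  zero-block if there is one and empty otherwise; since blocks are nonempty, the value is 0
  exactly when there is no zero-block.\<close>

definition zero_half_size :: "int set set \<Rightarrow> nat" where
  "zero_half_size P = card (abs ` \<Union>{B \<in> P. uminus ` B = B})"

definition block_pairs :: "int set set \<Rightarrow> int set set set" where
  "block_pairs P = {{B, uminus ` B} | B. B \<in> P \<and> uminus ` B \<noteq> B}"

definition Bn_bot :: "nat \<Rightarrow> int set set" where
  "Bn_bot n = {{j} | j. j \<in> pm n}"

definition intersect_minimally :: "nat \<Rightarrow> int set set set \<Rightarrow> bool" where
  "intersect_minimally n \<P> \<longleftrightarrow> common_refinement \<P> = Bn_bot n"

lemma common_refinement_pair:
  assumes "partition_on A P" "partition_on A Q"
  shows "common_refinement {P, Q} = {B \<inter> C | B C. B \<in> P \<and> C \<in> Q \<and> B \<inter> C \<noteq> {}}"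
proof (intro equalityI subsetI)
  fix X assume "X \<in> common_refinement {P, Q}"
  then show "X \<in> {B \<inter> C | B C. B \<in> P \<and> C \<in> Q \<and> B \<inter> C \<noteq> {}}"
    by (auto simp: common_refinement)
next
  fix X assume "X \<in> {B \<inter> C | B C. B \<in> P \<and> C \<in> Q \<and> B \<inter> C \<noteq> {}}"
  then obtain B C where BC: "B \<in> P" "C \<in> Q" "X = B \<inter> C" "X \<noteq> {}"
    by blast
  define f where "f = (\<lambda>R. if R = P then B else C)"
  have "B = C" if "P = Q"
    using BC that assms(1) by (auto simp: partition_on_def disjoint_def)
  then have "f \<in> (\<Pi> R\<in>{P, Q}. R)" "\<Inter> (f ` {P, Q}) = X"
    using BC by (auto simp: f_def)
  then show "X \<in> common_refinement {P, Q}"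
    using BC unfolding common_refinement by blast
qed

definition NB :: "nat \<Rightarrow> int set set \<Rightarrow> nat \<Rightarrow> nat" where
  "NB n P l =
     card {P'. Bn_partition n P' \<and> card (block_pairs P') = l \<and> intersect_minimally n {P, P'}}"

fun double_fact :: "nat \<Rightarrow> nat" where
  "double_fact 0 = 1"
| "double_fact (Suc 0) = 1"
| "double_fact (Suc (Suc m)) = Suc (Suc m) * double_fact m"

lemma double_fact_even: "double_fact (2 * m) = 2 ^ m * fact m"
  by (induction m) (auto simp: algebra_simps)

text \<open>Multivariate polynomials: finitely supported maps from exponent vectors to coefficients,
  multiplied by convolution.\<close>

type_synonym mpoly_rat = "(nat \<Rightarrow>\<^sub>0 nat) \<Rightarrow>\<^sub>0 rat"

definition Xvar :: "nat \<Rightarrow> mpoly_rat" where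
  "Xvar \<alpha> = Poly_Mapping.single (Poly_Mapping.single \<alpha> 1) 1"

text \<open>The coefficient of \<open>\<Prod>\<alpha>=1..k. x\<^sub>\<alpha> ^ a \<alpha>\<close> in \<open>G\<close>.\<close>

definition mcoeff :: "nat \<Rightarrow> (nat \<Rightarrow> nat) \<Rightarrow> mpoly_rat \<Rightarrow> rat" where
  "mcoeff k a G = Poly_Mapping.lookup G (\<Sum>\<alpha>=1..k. Poly_Mapping.single \<alpha> (a \<alpha>))"

end

theory Submission
  imports Defs
begin

text \<open>
  A \<open>B\<^sub>n\<close>-partition with \<open>l\<close> block pairs is the partition into level sets of an odd function
  \<open>f : [\<plusminus>n] \<rightarrow> {-l, \<dots>, l}\<close> that takes every nonzero value, and exactly \<open>2\<^sup>l l!\<close> such functions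
  (the labellings of the signed blocks) have the same level sets. The partition meets \<open>P\<close>
  minimally iff \<open>f\<close> is injective on every block of \<open>P\<close>. Dropping surjectivity, the odd
  functions with values in \<open>U \<union> -U \<union> {0}\<close>, \<open>|U| = u\<close>, that are injective on the blocks of \<open>P\<close> are
  chosen independently on the positive half of the zero-block and on one block of each pair, so
  there are \<open>2\<^sup>z z! (u choose z) \<Prod>\<^sub>\<alpha> i\<^sub>\<alpha>! (2u + 1 choose i\<^sub>\<alpha>)\<close> of them, where \<open>z\<close> is the half-size of the
  zero-block. Moebius inversion over \<open>U\<close> recovers the surjective ones as an alternating sum.
  The right-hand side is the same alternating sum: expand
  \<open>(A - 1)\<^bsup>l-z\<^esup> A\<^bsup>z\<^esup>\<close>, \<open>A = \<Prod>\<^sub>\<alpha> (1 + x\<^sub>\<alpha>)\<^sup>2\<close>, binomially, and note that summing the coefficient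
  of \<open>\<Prod>\<^sub>\<alpha> (1 + x\<^sub>\<alpha>)\<^bsup>2u\<^esup>\<close> over the exponents \<open>i\<^sub>\<alpha>\<close> and \<open>i\<^sub>\<alpha> - 1\<close> gives \<open>\<Prod>\<^sub>\<alpha> (2u + 1 choose i\<^sub>\<alpha>)\<close> by Pascal's rule.
\<close>

subsection \<open>Counting injective and odd functions\<close>

text \<open>Values are chosen one point at a time: each point already placed rules out one whole
  fibre of \<open>h\<close>, that is \<open>c\<close> values, so the choices form a falling product.
  The uses below are \<open>h = abs\<close> with \<open>c = 2\<close> and \<open>h = id\<close> with
  \<open>c = 1\<close>.\<close>

lemma card_PiE_inj_on_comp:
  assumes "finite A" "finite S"
    and fib: "\<And>u. u \<in> h ` S \<Longrightarrow> card {y \<in> S. h y = u} = c"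
  shows "card {g \<in> A \<rightarrow>\<^sub>E S. inj_on (h \<circ> g) A} =
    c ^ card A * (fact (card A) * (card (h ` S) choose card A))"
  using assms(1)
proof (induction A rule: finite_induct)
  case empty
  have "{g \<in> {} \<rightarrow>\<^sub>E S. inj_on (h \<circ> g) {}} = {\<lambda>_. undefined}" by auto
  then show ?case by simp
next
  case (insert x A)
  let ?G = "\<lambda>A. {g \<in> A \<rightarrow>\<^sub>E S. inj_on (h \<circ> g) A}"
  let ?Y = "\<lambda>g. {y \<in> S. h y \<notin> (h \<circ> g) ` A}"
  have card_Y: "card (?Y g) = c * (card (h ` S) - card A)" if g: "g \<in> ?G A" for g
  proof -
    have sub: "(h \<circ> g) ` A \<subseteq> h ` S" using g by auto
    have "?Y g = (\<Union>u\<in>h ` S - (h \<circ> g) ` A. {y \<in> S. h y = u})"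
      by (auto simp: image_iff) metis
    also have "card \<dots> = (\<Sum>u\<in>h ` S - (h \<circ> g) ` A. card {y \<in> S. h y = u})"
      using assms(2) by (intro card_UN_disjoint) auto
    also have "\<dots> = c * card (h ` S - (h \<circ> g) ` A)"
      using fib by simp
    also have "card (h ` S - (h \<circ> g) ` A) = card (h ` S) - card A"
    proof -
      have "card ((h \<circ> g) ` A) = card A" using g by (intro card_image) auto
      then show ?thesis
        using sub insert.hyps by (metis card_Diff_subset finite_imageI)
    qed
    finally show ?thesis .
  qed
  \<comment> \<open>Extension by a value at \<open>x\<close> is undone by resetting \<open>x\<close>
    to \<open>undefined\<close>, the value that an extensional function takes off its
    domain.\<close>
  have "bij_betw (\<lambda>(g, y). g(x := y)) (Sigma (?G A) ?Y) (?G (insert x A))"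
  proof (rule bij_betw_byWitness[where f' = "\<lambda>g. (g(x := undefined), g x)"])
    show "\<forall>a\<in>Sigma (?G A) ?Y. (\<lambda>g. (g(x := undefined), g x)) ((\<lambda>(g, y). g(x := y)) a) = a"
    proof clarsimp
      fix g :: "'a \<Rightarrow> 'b" assume "g \<in> A \<rightarrow>\<^sub>E S"
      then show "g(x := undefined) = g" using insert.hyps(2) by (simp add: PiE_arb[of g] fun_upd_idem)
    qed
    show "\<forall>a\<in>?G (insert x A). (\<lambda>(g, y). g(x := y)) ((\<lambda>g. (g(x := undefined), g x)) a) = a"
      by auto
    show "(\<lambda>(g, y). g(x := y)) ` Sigma (?G A) ?Y \<subseteq> ?G (insert x A)"
    proof
      fix f assume "f \<in> (\<lambda>(g, y). g(x := y)) ` Sigma (?G A) ?Y"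
      then obtain g y where f: "f = g(x := y)" and g: "g \<in> A \<rightarrow>\<^sub>E S" "inj_on (h \<circ> g) A"
        and y: "y \<in> S" "h y \<notin> (h \<circ> g) ` A"
        by auto
      have "inj_on (h \<circ> f) A"
        using g(2) insert.hyps f by (auto simp: inj_on_def)
      moreover have "(h \<circ> f) ` A = (h \<circ> g) ` A"
        using insert.hyps f by (intro image_cong) auto
      moreover have "f \<in> insert x A \<rightarrow>\<^sub>E S"
        using f g y insert.hyps by (auto simp: PiE_fun_upd)
      ultimately show "f \<in> ?G (insert x A)"
        using f y insert.hyps by (simp add: inj_on_insert)
    qed
    show "(\<lambda>g. (g(x := undefined), g x)) ` ?G (insert x A) \<subseteq> Sigma (?G A) ?Y"
    proof
      fix p assume "p \<in> (\<lambda>g. (g(x := undefined), g x)) ` ?G (insert x A)"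
      then obtain g where p: "p = (g(x := undefined), g x)"
        and g: "g \<in> insert x A \<rightarrow>\<^sub>E S" "inj_on (h \<circ> g) (insert x A)"
        by auto
      have "(h \<circ> g(x := undefined)) ` A = (h \<circ> g) ` A"
        using insert.hyps by (intro image_cong) auto
      moreover have "inj_on (h \<circ> g(x := undefined)) A"
        using g(2) insert.hyps by (auto simp: inj_on_def)
      moreover have "g(x := undefined) \<in> A \<rightarrow>\<^sub>E S"
        using g(1) insert.hyps by (auto simp: PiE_iff extensional_def)
      ultimately show "p \<in> Sigma (?G A) ?Y"
        using p g insert.hyps by (simp add: inj_on_insert PiE_iff)
    qed
  qed
  then have "card (?G (insert x A)) = card (Sigma (?G A) ?Y)"
    by (simp add: bij_betw_same_card)
  also have "\<dots> = (\<Sum>g\<in>?G A. card (?Y g))"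
    using insert.hyps assms(2) by (intro card_SigmaI) (auto intro!: finite_PiE simp: finite_Collect_conjI)
  also have "\<dots> = card (?G A) * (c * (card (h ` S) - card A))"
    using card_Y by simp
  also have "\<dots> = c ^ card (insert x A) *
      (fact (card A) * ((card (h ` S) - card A) * (card (h ` S) choose card A)))"
    unfolding insert.IH using insert.hyps by (simp add: mult_ac)
  \<comment> \<open>Both sides equal \<open>N * ((N - 1) choose card A)\<close>, where
    \<open>N\<close> is the number of values of \<open>h\<close> on \<open>S\<close>. Truncated
    subtraction does no harm, since the binomial coefficient is 0 once \<open>card A\<close> exceeds
    \<open>N\<close>.\<close>
  also have "(card (h ` S) - card A) * (card (h ` S) choose card A) =
      Suc (card A) * (card (h ` S) choose Suc (card A))"
    by (simp only: binomial_absorb_comp binomial_absorption)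
  finally show ?case using insert.hyps by (simp add: algebra_simps)
qed

text \<open>The nonzero labels whose absolute values lie in \<open>U\<close>. For positive
  \<open>U\<close> the label 0 is not among them and is added by \<open>insert 0\<close> where a
  zero-block is allowed.\<close>

definition signed :: "int set \<Rightarrow> int set" where
  "signed U = {s. \<bar>s\<bar> \<in> U}"

lemma signed_eq:
  assumes "U \<subseteq> {0<..}" shows "signed U = U \<union> uminus ` U"
  using assms by (force simp: signed_def abs_if image_iff split: if_splits)

lemma zero_notin_signed: "U \<subseteq> {0<..} \<Longrightarrow> 0 \<notin> signed U"
  by (auto simp: signed_def)

lemma finite_signed: "finite U \<Longrightarrow> U \<subseteq> {0<..} \<Longrightarrow> finite (signed U)"
  by (simp add: signed_eq)

lemma abs_image_signed: "U \<subseteq> {0<..} \<Longrightarrow> abs ` signed U = U"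
  by (force simp: signed_eq image_iff)

lemma card_signed:
  assumes "finite U" "U \<subseteq> {0<..}"
  shows "card (signed U) = 2 * card U"
proof -
  have "- x \<notin> U" if "x \<in> U" for x
    using that assms(2) by (metis greaterThan_iff neg_0_less_iff_less not_less_iff_gr_or_eq subsetD)
  then have "U \<inter> uminus ` U = {}" by auto
  then show ?thesis
    using assms by (simp add: signed_eq card_Un_disjoint card_image)
qed

text \<open>The fibre of \<open>abs\<close> over \<open>u\<close> is \<open>{u, -u}\<close>, of size
  2. This count serves both for the positive half of the zero-block and for the labellings of
  representatives of block pairs.\<close>

lemma card_PiE_inj_on_abs:
  assumes "finite A" "finite U" "U \<subseteq> {0<..}"
  shows "card {g \<in> A \<rightarrow>\<^sub>E signed U. inj_on (abs \<circ> g) A} =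
    2 ^ card A * (fact (card A) * (card U choose card A))"
proof -
  have "card {y \<in> signed U. \<bar>y\<bar> = u} = 2" if "u \<in> abs ` signed U" for u
  proof -
    from that have "u \<in> U" by (simp add: abs_image_signed assms)
    then have "{y \<in> signed U. \<bar>y\<bar> = u} = {u, -u}" "u \<noteq> - u"
      using assms by (auto simp: signed_def)
    then show ?thesis by simp
  qed
  from card_PiE_inj_on_comp[OF assms(1) finite_signed[OF assms(2,3)] this] show ?thesis
    by (simp add: abs_image_signed assms)
qed

lemma card_PiE_inj_on:
  assumes "finite A" "finite S"
  shows "card {g \<in> A \<rightarrow>\<^sub>E S. inj_on g A} = fact (card A) * (card S choose card A)"
proof -
  have "card {y \<in> S. id y = u} = 1" if "u \<in> id ` S" for u
  proof -
    from that have "{y \<in> S. id y = u} = {u}" by auto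
    then show ?thesis by simp
  qed
  from card_PiE_inj_on_comp[OF assms this] show ?thesis by (simp add: comp_def)
qed

text \<open>An odd function on \<open>X\<close> is determined by its restriction to the half
  \<open>R\<close>. The pieces \<open>A \<alpha>\<close> of \<open>R\<close> are disjoint, so the
  restrictions to them can be chosen independently from the sets \<open>F \<alpha>\<close>.\<close>

lemma card_odd_functions:
  fixes A :: "nat \<Rightarrow> int set" and S :: "int set"
  assumes "finite K" and disj: "disjoint_family_on A K"
    and R: "R = (\<Union>\<alpha>\<in>K. A \<alpha>)" and X: "X = R \<union> uminus ` R" and "R \<inter> uminus ` R = {}"
    and S: "uminus ` S \<subseteq> S"
    and F: "\<And>\<alpha>. \<alpha> \<in> K \<Longrightarrow> F \<alpha> \<subseteq> A \<alpha> \<rightarrow>\<^sub>E S"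
  shows "card {f \<in> X \<rightarrow>\<^sub>E S. (\<forall>x\<in>X. f (- x) = - f x) \<and> (\<forall>\<alpha>\<in>K. restrict f (A \<alpha>) \<in> F \<alpha>)} =
    (\<Prod>\<alpha>\<in>K. card (F \<alpha>))"
proof -
  let ?D = "{f \<in> X \<rightarrow>\<^sub>E S. (\<forall>x\<in>X. f (- x) = - f x) \<and> (\<forall>\<alpha>\<in>K. restrict f (A \<alpha>) \<in> F \<alpha>)}"
  \<comment> \<open>Disjointness makes the index of the piece containing a point of \<open>R\<close>
    unique.\<close>
  define idx where "idx x = (THE \<alpha>. \<alpha> \<in> K \<and> x \<in> A \<alpha>)" for x
  have idx: "idx x = \<alpha>" if "\<alpha> \<in> K" "x \<in> A \<alpha>" for x \<alpha>
    unfolding idx_def using that disj by (intro the_equality) (auto simp: disjoint_family_on_def)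
  let ?\<Phi> = "\<lambda>f. \<lambda>\<alpha>\<in>K. restrict f (A \<alpha>)"
  \<comment> \<open>Gluing gives the values on \<open>R\<close>; the values on its negative are
    forced by oddness.\<close>
  let ?\<Psi> = "\<lambda>g. \<lambda>x\<in>X. if x \<in> R then g (idx x) x else - g (idx (- x)) (- x)"
  have neg: "x \<in> R \<Longrightarrow> - x \<notin> R" for x using assms(5) by force
  have XR: "x \<in> X \<longleftrightarrow> x \<in> R \<or> - x \<in> R" for x unfolding X by (force simp: image_iff)
  have AR: "\<alpha> \<in> K \<Longrightarrow> x \<in> A \<alpha> \<Longrightarrow> x \<in> R" for \<alpha> x using R by auto
  have RA: "x \<in> R \<Longrightarrow> idx x \<in> K \<and> x \<in> A (idx x)" for x using R idx by auto
  have res: "restrict (?\<Psi> g) (A \<alpha>) = g \<alpha>" if "g \<in> PiE K F" "\<alpha> \<in> K" for g \<alpha>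
  proof
    fix x
    have "g \<alpha> \<in> A \<alpha> \<rightarrow>\<^sub>E S" using that F by (metis PiE_mem subsetD)
    moreover have "x \<in> R" "x \<in> X" "idx x = \<alpha>" if "x \<in> A \<alpha>"
      using that AR XR idx \<open>\<alpha> \<in> K\<close> by blast+
    ultimately show "restrict (?\<Psi> g) (A \<alpha>) x = g \<alpha> x"
      by (cases "x \<in> A \<alpha>") (simp_all add: PiE_arb[of "g \<alpha>"])
  qed
  have "bij_betw ?\<Phi> ?D (PiE K F)"
  proof (rule bij_betw_byWitness[where f' = ?\<Psi>])
    show "\<forall>f\<in>?D. ?\<Psi> (?\<Phi> f) = f"
    proof (intro ballI ext)
      fix f x assume f: "f \<in> ?D"
      show "?\<Psi> (?\<Phi> f) x = f x"
      proof (cases "x \<in> X")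
        case False
        then show ?thesis using f by (auto simp: PiE_arb[of f])
      next
        case True
        show ?thesis
        proof (cases "x \<in> R")
          case True
          then show ?thesis using RA[OF True] XR by simp
        next
          case False
          with True have "- x \<in> R" using XR by auto
          then show ?thesis using RA[of "-x"] False f True by simp
        qed
      qed
    qed
    show "\<forall>g\<in>PiE K F. ?\<Phi> (?\<Psi> g) = g"
    proof (intro ballI, rule ext)
      fix g \<alpha> assume g: "g \<in> PiE K F"
      show "?\<Phi> (?\<Psi> g) \<alpha> = g \<alpha>"
      proof (cases "\<alpha> \<in> K")
        case True
        then show ?thesis using res[OF g True] by (simp only: restrict_apply' if_True)
      next
        case False
        then show ?thesis using g by (auto simp: PiE_arb[of g])
      qed
    qed
    show "?\<Phi> ` ?D \<subseteq> PiE K F" by auto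
    show "?\<Psi> ` PiE K F \<subseteq> ?D"
    proof (intro image_subsetI)
      fix g assume g: "g \<in> PiE K F"
      have gS: "g (idx x) x \<in> S" if "x \<in> R" for x
      proof -
        have "g (idx x) \<in> A (idx x) \<rightarrow>\<^sub>E S" using RA[OF that] g F by (metis PiE_mem subsetD)
        then show ?thesis using RA[OF that] by (auto simp: PiE_iff)
      qed
      have "?\<Psi> g x \<in> S" if "x \<in> X" for x
        using gS[of x] gS[of "-x"] S XR that by auto
      moreover have "?\<Psi> g (- x) = - ?\<Psi> g x" if "x \<in> X" for x
        using XR that neg[of x] neg[of "- x"] by auto
      moreover have "\<forall>\<alpha>\<in>K. restrict (?\<Psi> g) (A \<alpha>) \<in> F \<alpha>"
        using res[OF g] g by (metis (no_types, lifting) PiE_mem)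
      ultimately show "?\<Psi> g \<in> ?D"
        by (simp only: mem_Collect_eq PiE_iff restrict_extensional) blast
    qed
  qed
  then have "card ?D = card (PiE K F)" by (rule bij_betw_same_card)
  then show ?thesis using assms(1) by (simp add: card_PiE)
qed

subsection \<open>Partitions into level sets\<close>

text \<open>When \<open>P\<close> is a partition of a set containing \<open>x\<close>, the union has
  a single member, so it is the block of \<open>x\<close>.\<close>

definition blk :: "'a set set \<Rightarrow> 'a \<Rightarrow> 'a set" where
  "blk P x = \<Union>{B \<in> P. x \<in> B}"

lemma blk_eq:
  assumes "partition_on X P" "B \<in> P" "x \<in> B"
  shows "blk P x = B"
proof -
  have "{B \<in> P. x \<in> B} = {B}"
    using assms by (auto simp: partition_on_def disjoint_def)
  then show ?thesis by (simp add: blk_def)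
qed

lemma blk_mem:
  assumes "partition_on X P" "x \<in> X"
  shows "blk P x \<in> P" "x \<in> blk P x"
proof -
  obtain B where "B \<in> P" "x \<in> B" using assms by (auto simp: partition_on_def)
  with blk_eq[OF assms(1) this] show "blk P x \<in> P" "x \<in> blk P x" by auto
qed

lemma mem_blk_iff:
  assumes "partition_on X P" "x \<in> X" "y \<in> X"
  shows "y \<in> blk P x \<longleftrightarrow> blk P y = blk P x"
proof
  show "blk P y = blk P x" if "y \<in> blk P x"
    using blk_eq[OF assms(1) blk_mem(1)[OF assms(1,2)] that] .
  show "y \<in> blk P x" if "blk P y = blk P x"
    using blk_mem(2)[OF assms(1,3)] that by simp
qed

definition ker_partition :: "'a set \<Rightarrow> ('a \<Rightarrow> 'b) \<Rightarrow> 'a set set" where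
  "ker_partition X f = (\<lambda>x. {y \<in> X. f y = f x}) ` X"

lemma partition_on_ker_partition: "partition_on X (ker_partition X f)"
  by (rule partition_onI) (auto simp: ker_partition_def disjnt_def)

lemma blk_ker_partition:
  assumes "x \<in> X" shows "blk (ker_partition X f) x = {y \<in> X. f y = f x}"
  using partition_on_ker_partition by (rule blk_eq) (use assms in \<open>auto simp: ker_partition_def\<close>)

lemma partition_on_eq_blk_image:
  assumes "partition_on X P" shows "P = blk P ` X"
proof -
  have "B \<in> blk P ` X" if "B \<in> P" for B
  proof -
    from that assms obtain x where "x \<in> B" "x \<in> X"
      by (metis partition_onD1 partition_onD3 UnionI all_not_in_conv)
    then show ?thesis using blk_eq[OF assms that] by blast
  qed
  then show ?thesis using blk_mem(1)[OF assms] by blast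
qed

text \<open>Partitions of \<open>X\<close> are equal when their equivalence relations are. This
  turns an equation between partitions into a pointwise condition on \<open>f\<close>, the form in
  which functions with a given kernel are counted.\<close>

lemma ker_partition_eq_iff:
  assumes Q: "partition_on X Q"
  shows "ker_partition X f = Q \<longleftrightarrow> (\<forall>x\<in>X. \<forall>y\<in>X. f x = f y \<longleftrightarrow> blk Q x = blk Q y)"
proof
  assume *: "ker_partition X f = Q"
  then show "\<forall>x\<in>X. \<forall>y\<in>X. f x = f y \<longleftrightarrow> blk Q x = blk Q y"
    by (auto simp: blk_ker_partition)
next
  assume *: "\<forall>x\<in>X. \<forall>y\<in>X. f x = f y \<longleftrightarrow> blk Q x = blk Q y"
  have "{y \<in> X. f y = f x} = blk Q x" if "x \<in> X" for x
  proof -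
    have "blk Q x \<subseteq> X" using blk_mem(1)[OF Q that] partition_onD1[OF Q] by auto
    then show ?thesis using * mem_blk_iff[OF Q that] that by auto
  qed
  then have "ker_partition X f = blk Q ` X"
    unfolding ker_partition_def by (intro image_cong) simp_all
  then show "ker_partition X f = Q"
    using partition_on_eq_blk_image[OF Q] by metis
qed

section \<open>The signed ground set, and \<open>B_n\<close>-partitions as level-set partitions of
  odd functions\<close>

lemma uminus_mem_pm [simp]: "- x \<in> pm n \<longleftrightarrow> x \<in> pm n"
  by (simp add: pm_def)

lemma zero_notin_pm [simp]: "0 \<notin> pm n"
  by (simp add: pm_def)

lemma finite_pm [simp]: "finite (pm n)"
  by (rule finite_subset[of _ "{- int n..int n}"]) (auto simp: pm_def)

lemma Bn_partition_partition_on: "Bn_partition n P \<Longrightarrow> partition_on (pm n) P"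
  by (simp add: Bn_partition_def)

lemma Bn_blk_uminus:
  assumes P: "Bn_partition n P" and x: "x \<in> pm n"
  shows "blk P (- x) = uminus ` blk P x"
proof -
  note part = Bn_partition_partition_on[OF P]
  have "uminus ` blk P x \<in> P" using P blk_mem(1)[OF part x] by (auto simp: Bn_partition_def)
  moreover have "- x \<in> uminus ` blk P x" using blk_mem(2)[OF part x] by auto
  ultimately show ?thesis by (rule blk_eq[OF part])
qed

text \<open>The condition \<open>blk P (- x) = blk P x\<close> expresses that the block of
  \<open>x\<close> is its own negative, hence the zero-block, and there is at most one such
  block.\<close>

lemma Bn_zero_block_unique:
  assumes "Bn_partition n P" "x \<in> pm n" "y \<in> pm n"
    and "blk P (- x) = blk P x" "blk P (- y) = blk P y"
  shows "blk P x = blk P y"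
proof -
  have "blk P x \<in> P" "blk P y \<in> P"
    using blk_mem(1)[OF Bn_partition_partition_on[OF assms(1)]] assms by auto
  moreover have "uminus ` blk P x = blk P x" "uminus ` blk P y = blk P y"
    using Bn_blk_uminus[OF assms(1)] assms by auto
  ultimately show ?thesis using assms(1) unfolding Bn_partition_def by blast
qed

lemma uminus_level_set:
  fixes f :: "int \<Rightarrow> int"
  assumes "\<forall>x\<in>pm n. f (- x) = - f x"
  shows "uminus ` {y \<in> pm n. f y = s} = {y \<in> pm n. f y = - s}"
proof (intro equalityI subsetI)
  fix y assume "y \<in> {y \<in> pm n. f y = - s}"
  then have "- y \<in> {y \<in> pm n. f y = s}" using assms by auto
  then have "- (- y) \<in> uminus ` {y \<in> pm n. f y = s}" by (rule imageI)
  then show "y \<in> uminus ` {y \<in> pm n. f y = s}" by simp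
qed (use assms in auto)

text \<open>Negation carries the level set of \<open>s\<close> to that of \<open>- s\<close>, so a
  self-negative block can only be the level set of 0.\<close>

lemma Bn_partition_ker_partition:
  fixes f :: "int \<Rightarrow> int"
  assumes odd: "\<forall>x\<in>pm n. f (- x) = - f x"
  shows "Bn_partition n (ker_partition (pm n) f)"
proof -
  have neg: "uminus ` {y \<in> pm n. f y = f x} = {y \<in> pm n. f y = f (- x)}" if "x \<in> pm n" for x
    using uminus_level_set[OF odd] odd that by simp
  have "f x = 0" if "x \<in> pm n" "uminus ` {y \<in> pm n. f y = f x} = {y \<in> pm n. f y = f x}" for x
  proof -
    have "x \<in> uminus ` {y \<in> pm n. f y = f x}" using that by auto
    then have "f x = f (- x)" using neg[OF that(1)] by simp
    then show ?thesis using odd that(1) by simp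
  qed
  note zero = this
  show ?thesis
    unfolding Bn_partition_def
  proof (intro conjI ballI impI)
    fix B assume "B \<in> ker_partition (pm n) f"
    then show "uminus ` B \<in> ker_partition (pm n) f"
      using neg by (auto simp: ker_partition_def)
  next
    fix B C assume "B \<in> ker_partition (pm n) f" "C \<in> ker_partition (pm n) f"
      and "uminus ` B = B" "uminus ` C = C"
    then obtain x y where "x \<in> pm n" "y \<in> pm n"
      and BC: "B = {z \<in> pm n. f z = f x}" "C = {z \<in> pm n. f z = f y}"
      and "uminus ` B = B" "uminus ` C = C"
      by (auto simp: ker_partition_def)
    then have "f x = 0" "f y = 0" using zero[of x] zero[of y] by blast+
    with BC show "B = C" by simp
  qed (rule partition_on_ker_partition)
qed

text \<open>The element \<open>u\<close> of \<open>U\<close> corresponds to the pair of level sets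
  of \<open>u\<close> and \<open>- u\<close>. Surjectivity onto \<open>signed U\<close> keeps these
  level sets nonempty, which makes the correspondence injective.\<close>

lemma card_block_pairs_ker_partition:
  fixes f :: "int \<Rightarrow> int"
  assumes odd: "\<forall>x\<in>pm n. f (- x) = - f x"
    and f: "f ` pm n \<subseteq> insert 0 (signed U)" "signed U \<subseteq> f ` pm n" and U: "U \<subseteq> {0<..}"
  shows "card (block_pairs (ker_partition (pm n) f)) = card U"
proof -
  define L where "L s = {y \<in> pm n. f y = s}" for s
  have ker: "ker_partition (pm n) f = (\<lambda>x. L (f x)) ` pm n"
    by (simp add: ker_partition_def L_def)
  have neg: "uminus ` L s = L (- s)" for s
    unfolding L_def by (rule uminus_level_set[OF odd])
  have ne: "\<exists>x. x \<in> pm n \<and> f x = s" if "\<bar>s\<bar> \<in> U" for s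
  proof -
    from that f(2) have "s \<in> f ` pm n" by (auto simp: signed_def)
    then show ?thesis by auto
  qed
  \<comment> \<open>A nonempty level set determines its value.\<close>
  have L_eq: "s = t" if "L s = L t" "\<bar>s\<bar> \<in> U" for s t
    using ne[OF that(2)] that(1) unfolding L_def by blast
  have pos: "u > 0" if "u \<in> U" for u using that U by auto
  have "inj_on (\<lambda>u. {L u, L (- u)}) U"
  proof (rule inj_onI)
    fix u v assume uv: "u \<in> U" "v \<in> U" and "{L u, L (- u)} = {L v, L (- v)}"
    then have "L u = L v \<or> L u = L (- v)" by (auto simp: doubleton_eq_iff)
    moreover have "\<bar>u\<bar> \<in> U" using uv(1) pos[OF uv(1)] by simp
    ultimately have "u = v \<or> u = - v" using L_eq[of u v] L_eq[of u "- v"] by blast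
    then show "u = v" using pos[OF uv(1)] pos[OF uv(2)] by linarith
  qed
  moreover have "(\<lambda>u. {L u, L (- u)}) ` U = block_pairs (ker_partition (pm n) f)"
  proof (intro equalityI subsetI)
    fix q assume "q \<in> (\<lambda>u. {L u, L (- u)}) ` U"
    then obtain u where u: "u \<in> U" and q: "q = {L u, L (- u)}" by auto
    obtain x where "x \<in> pm n" "f x = u" using ne[of u] u pos[OF u] by auto
    then have "L u \<in> ker_partition (pm n) f" using ker by auto
    moreover have "L (- u) \<noteq> L u"
    proof
      assume "L (- u) = L u"
      then have "- u = u" by (rule L_eq) (use u pos[OF u] in simp)
      with pos[OF u] show False by simp
    qed
    ultimately have "\<exists>B. q = {B, uminus ` B} \<and> B \<in> ker_partition (pm n) f \<and> uminus ` B \<noteq> B"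
      by (intro exI[of _ "L u"]) (simp add: neg q)
    then show "q \<in> block_pairs (ker_partition (pm n) f)"
      by (simp add: block_pairs_def)
  next
    fix q assume "q \<in> block_pairs (ker_partition (pm n) f)"
    then obtain x where x: "x \<in> pm n" and q: "q = {L (f x), uminus ` L (f x)}"
      and "uminus ` L (f x) \<noteq> L (f x)"
      by (auto simp: block_pairs_def ker)
    then have neq: "L (- f x) \<noteq> L (f x)" and q': "q = {L (f x), L (- f x)}"
      by (simp_all add: neg)
    have "f x \<noteq> 0" using neq by (metis minus_zero)
    then have "\<bar>f x\<bar> \<in> U" using f(1) x by (auto simp: signed_def)
    moreover have "q = {L \<bar>f x\<bar>, L (- \<bar>f x\<bar>)}"
      using q' by (simp add: abs_if insert_commute)
    ultimately show "q \<in> (\<lambda>u. {L u, L (- u)}) ` U" by blast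
  qed
  ultimately show ?thesis by (metis card_image)
qed

text \<open>The meet is minimal when every nonempty \<open>B \<inter> C\<close> is a singleton, and
  two points of \<open>B\<close> share a block \<open>C\<close> of \<open>Q\<close> exactly when
  their \<open>blk Q\<close> agree.\<close>

lemma intersect_minimally_iff:
  assumes P: "partition_on (pm n) P" and Q: "partition_on (pm n) Q"
  shows "intersect_minimally n {P, Q} \<longleftrightarrow>
    (\<forall>B\<in>P. \<forall>x\<in>B. \<forall>y\<in>B. blk Q x = blk Q y \<longrightarrow> x = y)"
proof
  have sub: "x \<in> pm n" if "B \<in> P" "x \<in> B" for B x using that P by (auto simp: partition_on_def)
  {
    assume *: "intersect_minimally n {P, Q}"
    show "\<forall>B\<in>P. \<forall>x\<in>B. \<forall>y\<in>B. blk Q x = blk Q y \<longrightarrow> x = y"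
    proof (intro ballI impI)
      fix B x y assume B: "B \<in> P" "x \<in> B" "y \<in> B" and eq: "blk Q x = blk Q y"
      have xy: "x \<in> blk Q x" "y \<in> blk Q x" "blk Q x \<in> Q"
        using blk_mem[OF Q] sub B eq by auto
      then have "B \<inter> blk Q x \<in> common_refinement {P, Q}"
        unfolding common_refinement_pair[OF P Q] using B by blast
      then obtain j where "B \<inter> blk Q x = {j}"
        using * by (auto simp: intersect_minimally_def Bn_bot_def)
      then show "x = y" using xy B by (metis IntI singletonD)
    qed
  next
    assume *: "\<forall>B\<in>P. \<forall>x\<in>B. \<forall>y\<in>B. blk Q x = blk Q y \<longrightarrow> x = y"
    have single: "B \<inter> C = {x}" if "B \<in> P" "C \<in> Q" "x \<in> B" "x \<in> C" for B C x
    proof -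
      have "y = x" if "y \<in> B" "y \<in> C" for y
        using * \<open>B \<in> P\<close> \<open>x \<in> B\<close> that
          blk_eq[OF Q \<open>C \<in> Q\<close> \<open>x \<in> C\<close>] blk_eq[OF Q \<open>C \<in> Q\<close> \<open>y \<in> C\<close>] by metis
      with that show ?thesis by blast
    qed
    show "intersect_minimally n {P, Q}"
      unfolding intersect_minimally_def common_refinement_pair[OF P Q] Bn_bot_def
    proof (intro equalityI subsetI)
      fix Y assume "Y \<in> {B \<inter> C |B C. B \<in> P \<and> C \<in> Q \<and> B \<inter> C \<noteq> {}}"
      then obtain B C x where "B \<in> P" "C \<in> Q" "x \<in> B" "x \<in> C" "Y = B \<inter> C" by blast
      then show "Y \<in> {{j} |j. j \<in> pm n}" using single sub by blast
    next
      fix Y assume "Y \<in> {{j} |j. j \<in> pm n}"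
      then obtain j where j: "j \<in> pm n" "Y = {j}" by blast
      then have "blk P j \<inter> blk Q j = Y"
        using single blk_mem[OF P j(1)] blk_mem[OF Q j(1)] by blast
      then show "Y \<in> {B \<inter> C |B C. B \<in> P \<and> C \<in> Q \<and> B \<inter> C \<noteq> {}}"
        using blk_mem[OF P j(1)] blk_mem[OF Q j(1)] j by blast
    qed
  }
qed

lemma intersect_minimally_ker_iff:
  assumes P: "partition_on (pm n) P"
  shows "intersect_minimally n {P, ker_partition (pm n) f} \<longleftrightarrow> (\<forall>B\<in>P. inj_on f B)"
proof -
  have "blk (ker_partition (pm n) f) x = blk (ker_partition (pm n) f) y \<longleftrightarrow> f x = f y"
    if "B \<in> P" "x \<in> B" "y \<in> B" for B x y
  proof -
    have "x \<in> pm n" "y \<in> pm n" using that partition_onD1[OF P] by auto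
    then show ?thesis using ker_partition_eq_iff[OF partition_on_ker_partition] by metis
  qed
  then show ?thesis
    unfolding intersect_minimally_iff[OF P partition_on_ker_partition] inj_on_def by simp
qed

subsection \<open>Odd functions with prescribed level sets\<close>

text \<open>Here \<open>b\<close> is an abstract block label, later \<open>blk Q\<close>, and
  \<open>R\<close> holds one point for each pair of opposite nonzero blocks. A function with kernel
  \<open>b\<close> is determined by its values on \<open>R\<close>, and these may be any elements of
  \<open>signed U\<close> with distinct absolute values.\<close>

lemma card_odd_functions_kernel:
  fixes b :: "int \<Rightarrow> 'c"
  assumes X: "\<And>x. x \<in> X \<Longrightarrow> - x \<in> X" "0 \<notin> X"
    and b_neg: "\<And>x y. x \<in> X \<Longrightarrow> y \<in> X \<Longrightarrow> b x = b y \<Longrightarrow> b (- x) = b (- y)"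
    and b_zero: "\<And>x y. x \<in> X \<Longrightarrow> y \<in> X \<Longrightarrow> b (- x) = b x \<Longrightarrow> b (- y) = b y \<Longrightarrow> b x = b y"
    and R: "finite R" "R \<subseteq> X" "\<And>r. r \<in> R \<Longrightarrow> b (- r) \<noteq> b r"
    and R_inj: "\<And>r s. r \<in> R \<Longrightarrow> s \<in> R \<Longrightarrow> b r = b s \<or> b r = b (- s) \<Longrightarrow> r = s"
    and R_ex: "\<And>x. x \<in> X \<Longrightarrow> b (- x) \<noteq> b x \<Longrightarrow> \<exists>r\<in>R. b x = b r \<or> b x = b (- r)"
    and U: "finite U" "U \<subseteq> {0<..}" "card U = card R"
  shows "card {f \<in> X \<rightarrow>\<^sub>E insert 0 (signed U). (\<forall>x\<in>X. f (- x) = - f x) \<and> signed U \<subseteq> f ` X \<and>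
    (\<forall>x\<in>X. \<forall>y\<in>X. f x = f y \<longleftrightarrow> b x = b y)} = 2 ^ card U * fact (card U)"
proof -
  let ?S = "{f \<in> X \<rightarrow>\<^sub>E insert 0 (signed U). (\<forall>x\<in>X. f (- x) = - f x) \<and> signed U \<subseteq> f ` X \<and>
    (\<forall>x\<in>X. \<forall>y\<in>X. f x = f y \<longleftrightarrow> b x = b y)}"
  let ?T = "{g \<in> R \<rightarrow>\<^sub>E signed U. inj_on (abs \<circ> g) R}"
  \<comment> \<open>\<open>rep x\<close> is the point of \<open>R\<close> whose block is that of
    \<open>x\<close> or its negative.\<close>
  obtain rep where rep: "\<And>x. x \<in> X \<Longrightarrow> b (- x) \<noteq> b x \<Longrightarrow> rep x \<in> R"
    "\<And>x. x \<in> X \<Longrightarrow> b (- x) \<noteq> b x \<Longrightarrow> b x = b (rep x) \<or> b x = b (- rep x)"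
    using R_ex by metis
  have RX: "r \<in> X" if "r \<in> R" for r using that R(2) by auto
  have rep_eq: "rep x = r"
    if x: "x \<in> X" "b (- x) \<noteq> b x" and r: "r \<in> R" "b x = b r \<or> b x = b (- r)" for x r
  proof (rule R_inj[OF rep(1)[OF x] r(1)])
    have "- (rep x) \<in> X" "- r \<in> X" "rep x \<in> X" "r \<in> X"
      using rep(1)[OF x] r(1) RX X(1) by auto
    then show "b (rep x) = b r \<or> b (rep x) = b (- r)"
      using rep(2)[OF x] r(2) b_neg[of "- rep x" r] b_neg[of "- rep x" "- r"] by auto
  qed
  have rep_R: "rep r = r" if "r \<in> R" for r
    using that R(3) RX by (intro rep_eq) auto
  have nz_neg: "b (- (- x)) \<noteq> b (- x)" if "b (- x) \<noteq> b x" for x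
    using that by auto
  have rep_neg: "rep (- x) = rep x" if x: "x \<in> X" "b (- x) \<noteq> b x" for x
  proof (rule rep_eq)
    have "rep x \<in> X" "- rep x \<in> X" using rep(1)[OF x] RX X(1) by auto
    then show "b (- x) = b (rep x) \<or> b (- x) = b (- rep x)"
      using rep(2)[OF x] b_neg[OF x(1), of "rep x"] b_neg[OF x(1), of "- rep x"] by auto
  qed (use x X(1) rep(1) nz_neg in auto)
  have rep_cong: "rep x = rep y" if "x \<in> X" "y \<in> X" "b (- y) \<noteq> b y" "b x = b y" for x y
  proof (rule rep_eq)
    show "b (- x) \<noteq> b x" using that b_neg[of x y] by auto
    show "b x = b (rep y) \<or> b x = b (- rep y)" using that rep(2) by auto
  qed (use that rep(1) in auto)
  \<comment> \<open>The inverse of restriction to \<open>R\<close>: value 0 on the zero-block,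
    \<open>g (rep x)\<close> on the block of the representative, and the opposite value on the
    negative of that block.\<close>
  define ext where "ext g = (\<lambda>x\<in>X. if b (- x) = b x then 0
    else if b x = b (rep x) then g (rep x) else - g (rep x))" for g :: "int \<Rightarrow> int"
  have ext_zero: "ext g x = 0" if "x \<in> X" "b (- x) = b x" for g x
    using that by (simp add: ext_def)
  have ext_pos: "ext g x = g (rep x)" if "x \<in> X" "b (- x) \<noteq> b x" "b x = b (rep x)" for g x
    using that by (simp add: ext_def)
  have ext_neg: "ext g x = - g (rep x)" if "x \<in> X" "b (- x) \<noteq> b x" "b x = b (- rep x)" for g x
    using that rep(1)[of x] R(3)[of "rep x"] by (simp add: ext_def)
  have ext_cases: "(b x = b (rep x) \<and> ext g x = g (rep x)) \<or>
      (b x = b (- rep x) \<and> ext g x = - g (rep x))"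
    if "x \<in> X" "b (- x) \<noteq> b x" for g x
    using that rep(2) ext_pos ext_neg by blast
  have ext_odd: "ext g (- x) = - ext g x" if x: "x \<in> X" for g x
  proof (cases "b (- x) = b x")
    case True
    then show ?thesis using x X(1) by (simp add: ext_zero)
  next
    case False
    have mX: "- x \<in> X" "rep x \<in> X" "- rep x \<in> X" using x X(1) RX rep(1)[OF x False] by auto
    from rep(2)[OF x False] show ?thesis
    proof
      assume *: "b x = b (rep x)"
      then have "b (- x) = b (- rep x)" using b_neg x mX by blast
      then show ?thesis
        using ext_pos[OF x False *] ext_neg[OF mX(1) nz_neg[OF False]] rep_neg[OF x False] by simp
    next
      assume *: "b x = b (- rep x)"
      then have "b (- x) = b (rep x)" using b_neg[OF x mX(3)] by simp
      then show ?thesis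
        using ext_neg[OF x False *] ext_pos[OF mX(1) nz_neg[OF False]] rep_neg[OF x False] by simp
    qed
  qed
  \<comment> \<open>Since \<open>card U = card R\<close>, absolute values that are distinct on
    \<open>R\<close> exhaust \<open>U\<close>; oddness then supplies both signs.\<close>
  have surj: "signed U \<subseteq> f ` X"
    if odd: "\<forall>x\<in>X. f (- x) = - f x" and g: "restrict f R \<in> ?T" for f
  proof
    have inj: "inj_on (abs \<circ> f) R" using g by (auto simp: inj_on_def)
    have "(abs \<circ> f) ` R \<subseteq> U" using g by (auto simp: signed_def PiE_iff)
    moreover have "card ((abs \<circ> f) ` R) = card U" using card_image[OF inj] U(3) by simp
    ultimately have RU: "(abs \<circ> f) ` R = U" using U(1) by (simp add: card_subset_eq)
    fix s assume "s \<in> signed U"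
    then have "\<bar>s\<bar> \<in> (abs \<circ> f) ` R" using RU by (simp add: signed_def)
    then obtain r where r: "r \<in> R" "\<bar>s\<bar> = \<bar>f r\<bar>" by auto
    then have "s = f r \<or> s = f (- r)" using odd RX[OF r(1)] by (auto simp: abs_eq_iff)
    then show "s \<in> f ` X" using RX[OF r(1)] X(1) by auto
  qed
  have "bij_betw (\<lambda>f. restrict f R) ?S ?T"
  proof (rule bij_betw_byWitness[where f' = ext])
    show "\<forall>f\<in>?S. ext (restrict f R) = f"
    proof
      fix f assume f: "f \<in> ?S"
      then have fker: "f x = f y \<longleftrightarrow> b x = b y" if "x \<in> X" "y \<in> X" for x y using that by blast
      have fodd: "f (- x) = - f x" if "x \<in> X" for x using that f by blast
      show "ext (restrict f R) = f"
      proof (rule extensionalityI[of _ X])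
        fix x assume x: "x \<in> X"
        show "ext (restrict f R) x = f x"
        proof (cases "b (- x) = b x")
          case True
          then have "f (- x) = f x" using fker[OF X(1)[OF x] x] by simp
          then show ?thesis using fodd[OF x] ext_zero[OF x True] by simp
        next
          case False
          have r: "rep x \<in> R" "rep x \<in> X" "- rep x \<in> X" using rep(1)[OF x False] RX X(1) by auto
          show ?thesis
            using ext_cases[OF x False, of "restrict f R"] r fker[OF x r(2)] fker[OF x r(3)]
              fodd[OF r(2)] by auto
        qed
      qed (use f in \<open>auto simp: ext_def PiE_iff\<close>)
    qed
    have rest: "restrict (ext g) R = g" if "g \<in> ?T" for g
    proof (rule extensionalityI[of _ R])
      fix r assume r: "r \<in> R"
      then show "restrict (ext g) R r = g r"
        using ext_pos[OF RX[OF r] R(3)[OF r], of g] rep_R[OF r] by simp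
    qed (use that in \<open>auto simp: PiE_iff\<close>)
    then show "\<forall>g\<in>?T. restrict (ext g) R = g" by blast
    show "(\<lambda>f. restrict f R) ` ?S \<subseteq> ?T"
    proof (intro image_subsetI)
      fix f assume f: "f \<in> ?S"
      then have fker: "f x = f y \<longleftrightarrow> b x = b y" if "x \<in> X" "y \<in> X" for x y using that by blast
      have fodd: "f (- x) = - f x" if "x \<in> X" for x using that f by blast
      have "f r \<in> signed U" if "r \<in> R" for r
      proof -
        have "f (- r) \<noteq> f r" using fker[of "- r" r] R(3)[OF that] RX[OF that] X(1) by auto
        then have "f r \<noteq> 0" using fodd[OF RX[OF that]] by auto
        then show ?thesis using f RX[OF that] by (auto simp: PiE_iff)
      qed
      moreover have "inj_on (abs \<circ> f) R"
      proof (rule inj_onI)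
        fix r s assume rs: "r \<in> R" "s \<in> R" and "(abs \<circ> f) r = (abs \<circ> f) s"
        then have "f r = f s \<or> f r = f (- s)" using fodd[OF RX[OF rs(2)]] by (auto simp: abs_eq_iff)
        then have "b r = b s \<or> b r = b (- s)"
          using fker[of r s] fker[of r "- s"] RX[OF rs(1)] RX[OF rs(2)] X(1) by auto
        then show "r = s" by (rule R_inj[OF rs])
      qed
      ultimately show "restrict f R \<in> ?T" by (auto simp: inj_on_def)
    qed
    show "ext ` ?T \<subseteq> ?S"
    proof (intro image_subsetI)
      fix g assume g: "g \<in> ?T"
      have g_mem: "g r \<in> signed U" "- g r \<in> signed U" "g r \<noteq> 0" if "r \<in> R" for r
      proof -
        show "g r \<in> signed U" using g that by (auto simp: PiE_iff)
        then show "- g r \<in> signed U" "g r \<noteq> 0" using U(2) by (auto simp: signed_def)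
      qed
      have g_inj: "r = s" if "r \<in> R" "s \<in> R" "\<bar>g r\<bar> = \<bar>g s\<bar>" for r s
        using g that by (auto simp: inj_on_def)
      have nz: "ext g x \<in> signed U" "ext g x \<noteq> 0" "\<bar>ext g x\<bar> = \<bar>g (rep x)\<bar>"
        if "x \<in> X" "b (- x) \<noteq> b x" for x
        using ext_cases[OF that, of g] g_mem[OF rep(1)[OF that]] by auto
      have PiE: "ext g \<in> X \<rightarrow>\<^sub>E insert 0 (signed U)"
        using ext_zero[of _ g] nz by (auto simp: PiE_iff ext_def[of g])
      have "ext g x = ext g y \<longleftrightarrow> b x = b y" if xy: "x \<in> X" "y \<in> X" for x y
      proof
        assume eq: "b x = b y"
        show "ext g x = ext g y"
        proof (cases "b (- y) = b y")
          case True
          then show ?thesis using eq b_neg[OF xy] ext_zero xy by simp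
        next
          case False
          then have "b (- x) \<noteq> b x" using eq b_neg[OF xy] by auto
          then show ?thesis
            using False eq rep_cong[OF xy False eq] ext_cases[of x g] ext_cases[of y g] xy
              R(3)[OF rep(1)[OF xy(2) False]] by auto
        qed
      next
        assume eq: "ext g x = ext g y"
        show "b x = b y"
        proof (cases "b (- x) = b x \<or> b (- y) = b y")
          case True
          then have "b (- x) = b x \<and> b (- y) = b y"
            using nz(2)[of x] nz(2)[of y] ext_zero[of x g] ext_zero[of y g] eq xy by metis
          then show ?thesis using b_zero[OF xy] by blast
        next
          case False
          then have x: "b (- x) \<noteq> b x" and y: "b (- y) \<noteq> b y" by auto
          have "rep x = rep y"
          proof (rule g_inj[OF rep(1)[OF xy(1) x] rep(1)[OF xy(2) y]])
            show "\<bar>g (rep x)\<bar> = \<bar>g (rep y)\<bar>"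
              using nz(3)[OF xy(1) x] nz(3)[OF xy(2) y] eq by simp
          qed
          \<comment> \<open>If \<open>x\<close> and \<open>y\<close> lay in opposite blocks,
            equality of the values would give \<open>g (rep x) = - g (rep x)\<close>, which is
            impossible for a nonzero label.\<close>
          then show ?thesis
            using ext_cases[OF xy(1) x, of g] ext_cases[OF xy(2) y, of g] eq
              g_mem(3)[OF rep(1)[OF xy(1) x]] by auto
        qed
      qed
      moreover have "signed U \<subseteq> ext g ` X"
        using surj[of "ext g"] ext_odd rest[OF g] g by simp
      ultimately show "ext g \<in> ?S" using PiE ext_odd by blast
    qed
  qed
  then have "card ?S = card ?T" by (rule bij_betw_same_card)
  also have "\<dots> = 2 ^ card U * fact (card U)"
    using card_PiE_inj_on_abs[OF R(1) U(1,2)] U(3) by simp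
  finally show ?thesis .
qed

text \<open>The previous count with \<open>b = blk Q\<close> and one representative for each block
  pair. The result depends on \<open>Q\<close> only through its number of block pairs, so passing
  from functions to partitions is division by a constant.\<close>

lemma card_odd_functions_ker_partition:
  assumes Q: "Bn_partition n Q" and l: "card (block_pairs Q) = card U"
    and U: "finite U" "U \<subseteq> {0<..}"
  shows "card {f \<in> pm n \<rightarrow>\<^sub>E insert 0 (signed U). (\<forall>x\<in>pm n. f (- x) = - f x) \<and>
    signed U \<subseteq> f ` pm n \<and> ker_partition (pm n) f = Q} = 2 ^ card U * fact (card U)"
proof -
  note part = Bn_partition_partition_on[OF Q]
  note neg = Bn_blk_uminus[OF Q]
  have finQ: "finite Q" using finite_elements[OF finite_pm part] .
  have "block_pairs Q = (\<lambda>B. {B, uminus ` B}) ` {B \<in> Q. uminus ` B \<noteq> B}"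
    by (auto simp: block_pairs_def)
  then have fin: "finite (block_pairs Q)" using finQ by simp
  have "\<exists>x\<in>pm n. q = {blk Q x, blk Q (- x)}" if "q \<in> block_pairs Q" for q
  proof -
    from that obtain B where B: "B \<in> Q" "q = {B, uminus ` B}" by (auto simp: block_pairs_def)
    then obtain x where "x \<in> pm n" "B = blk Q x" using partition_on_eq_blk_image[OF part] by blast
    then show ?thesis using B neg by blast
  qed
  then obtain r where r: "\<And>q. q \<in> block_pairs Q \<Longrightarrow> r q \<in> pm n"
    "\<And>q. q \<in> block_pairs Q \<Longrightarrow> q = {blk Q (r q), blk Q (- r q)}"
    by metis
  let ?R = "r ` block_pairs Q"
  have pair: "{blk Q x, blk Q (- x)} \<in> block_pairs Q" if "x \<in> pm n" "blk Q (- x) \<noteq> blk Q x" for x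
  proof -
    have "blk Q x \<in> Q" using blk_mem(1)[OF part that(1)] .
    then show ?thesis using that neg[OF that(1)] by (auto simp: block_pairs_def)
  qed
  \<comment> \<open>If the two blocks coincided, \<open>q\<close> would be a singleton, but a block
    pair has two distinct members.\<close>
  have nonzero: "blk Q (- r q) \<noteq> blk Q (r q)" if "q \<in> block_pairs Q" for q
  proof
    assume "blk Q (- r q) = blk Q (r q)"
    then have q: "q = {blk Q (r q)}" using r(2)[OF that] by simp
    have "\<exists>B. q = {B, uminus ` B} \<and> B \<in> Q \<and> uminus ` B \<noteq> B"
      using that by (simp add: block_pairs_def)
    then obtain B where B: "q = {B, uminus ` B}" "uminus ` B \<noteq> B"
      by (elim exE conjE)
    have "{B, uminus ` B} = {blk Q (r q)}" using B(1) q by (rule subst)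
    then have "uminus ` B = B" by (metis insertI1 insertI2 singletonD)
    then show False using B(2) by contradiction
  qed
  \<comment> \<open>The pair \<open>q\<close> can be recovered from \<open>r q\<close>, so distinct
    pairs have distinct representatives.\<close>
  have "inj_on r (block_pairs Q)"
    using r(2) by (intro inj_onI) metis
  then have cardR: "card U = card ?R" using l by (simp add: card_image)
  have "card {f \<in> pm n \<rightarrow>\<^sub>E insert 0 (signed U). (\<forall>x\<in>pm n. f (- x) = - f x) \<and>
      signed U \<subseteq> f ` pm n \<and> (\<forall>x\<in>pm n. \<forall>y\<in>pm n. f x = f y \<longleftrightarrow> blk Q x = blk Q y)} =
      2 ^ card U * fact (card U)"
  proof (rule card_odd_functions_kernel[where R = ?R])
    fix x y assume "x \<in> pm n" "y \<in> pm n" "blk Q x = blk Q y"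
    then show "blk Q (- x) = blk Q (- y)" using neg by simp
  next
    fix x y assume "x \<in> pm n" "y \<in> pm n" "blk Q (- x) = blk Q x" "blk Q (- y) = blk Q y"
    then show "blk Q x = blk Q y" by (rule Bn_zero_block_unique[OF Q])
  next
    fix s t assume "s \<in> ?R" "t \<in> ?R" and eq: "blk Q s = blk Q t \<or> blk Q s = blk Q (- t)"
    then obtain p q where p: "p \<in> block_pairs Q" "s = r p" and q: "q \<in> block_pairs Q" "t = r q"
      by auto
    have X: "s \<in> pm n" "t \<in> pm n" "- t \<in> pm n" using r(1) p q by auto
    have "{blk Q s, blk Q (- s)} = {blk Q t, blk Q (- t)}"
      using eq
    proof
      assume "blk Q s = blk Q t"
      then show ?thesis using neg[OF X(1)] neg[OF X(2)] by simp
    next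
      assume "blk Q s = blk Q (- t)"
      moreover from this have "blk Q (- s) = blk Q t" using neg[OF X(1)] neg[OF X(3)] by simp
      ultimately show ?thesis by (simp add: insert_commute)
    qed
    then have "p = q" using r(2)[OF p(1)] r(2)[OF q(1)] p(2) q(2) by simp
    then show "s = t" using p q by simp
  next
    fix x assume x: "x \<in> pm n" "blk Q (- x) \<noteq> blk Q x"
    let ?q = "{blk Q x, blk Q (- x)}"
    have "blk Q x \<in> {blk Q (r ?q), blk Q (- r ?q)}" using r(2)[OF pair[OF x]] by blast
    then show "\<exists>s\<in>?R. blk Q x = blk Q s \<or> blk Q x = blk Q (- s)"
      using pair[OF x] by blast
  next
    show "\<And>s. s \<in> ?R \<Longrightarrow> blk Q (- s) \<noteq> blk Q s" using nonzero by auto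
    show "?R \<subseteq> pm n" using r(1) by auto
  qed (use U cardR fin in simp_all)
  then show ?thesis by (simp only: ker_partition_eq_iff[OF part])
qed

section \<open>Odd functions that are injective on the blocks of \<open>P\<close>\<close>

definition proper_odd :: "nat \<Rightarrow> int set set \<Rightarrow> int set \<Rightarrow> (int \<Rightarrow> int) set" where
  "proper_odd n P U = {f \<in> pm n \<rightarrow>\<^sub>E insert 0 (signed U).
     (\<forall>x\<in>pm n. f (- x) = - f x) \<and> (\<forall>B\<in>P. inj_on f B)}"

lemma finite_proper_odd: "finite U \<Longrightarrow> U \<subseteq> {0<..} \<Longrightarrow> finite (proper_odd n P U)"
  unfolding proper_odd_def
  by (rule finite_subset[OF _ finite_PiE[of "pm n" "\<lambda>_. insert 0 (signed U)"]])
    (auto simp: finite_signed)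

text \<open>The functions are grouped by kernel. The kernels that occur are exactly the partitions
  counted by \<open>NB\<close>, and each arises from the same number of functions.\<close>

lemma card_proper_odd_onto:
  assumes P: "Bn_partition n P" and U: "finite U" "U \<subseteq> {0<..}"
  shows "card {f \<in> proper_odd n P U. signed U \<subseteq> f ` pm n} =
    NB n P (card U) * (2 ^ card U * fact (card U))"
proof -
  let ?N = "{Q. Bn_partition n Q \<and> card (block_pairs Q) = card U \<and> intersect_minimally n {P, Q}}"
  let ?E = "{f \<in> proper_odd n P U. signed U \<subseteq> f ` pm n}"
  let ?F = "\<lambda>Q. {f \<in> pm n \<rightarrow>\<^sub>E insert 0 (signed U). (\<forall>x\<in>pm n. f (- x) = - f x) \<and>
    signed U \<subseteq> f ` pm n \<and> ker_partition (pm n) f = Q}"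
  note part = Bn_partition_partition_on[OF P]
  have "?E = (\<Union>Q\<in>?N. ?F Q)"
  proof (intro equalityI subsetI)
    fix f assume f: "f \<in> ?E"
    then have odd: "\<forall>x\<in>pm n. f (- x) = - f x" and im: "signed U \<subseteq> f ` pm n"
      and inj: "\<forall>B\<in>P. inj_on f B" and ran: "f \<in> pm n \<rightarrow>\<^sub>E insert 0 (signed U)"
      by (auto simp: proper_odd_def)
    have "f ` pm n \<subseteq> insert 0 (signed U)" using ran by (auto simp: PiE_iff)
    then have "ker_partition (pm n) f \<in> ?N"
      using Bn_partition_ker_partition[OF odd] card_block_pairs_ker_partition[OF odd _ im U(2)]
        intersect_minimally_ker_iff[OF part, of f] inj by simp
    moreover have "f \<in> ?F (ker_partition (pm n) f)" using odd im ran by simp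
    ultimately show "f \<in> (\<Union>Q\<in>?N. ?F Q)" by blast
  next
    fix f assume "f \<in> (\<Union>Q\<in>?N. ?F Q)"
    then have "intersect_minimally n {P, ker_partition (pm n) f}" and
      f: "f \<in> ?F (ker_partition (pm n) f)" by blast+
    then have "\<forall>B\<in>P. inj_on f B" using intersect_minimally_ker_iff[OF part, of f] by simp
    then show "f \<in> ?E" using f by (simp add: proper_odd_def)
  qed
  also have "card \<dots> = (\<Sum>Q\<in>?N. card (?F Q))"
  proof (rule card_UN_disjoint)
    show "finite ?N"
      by (rule finite_subset[OF _ finitely_many_partition_on[OF finite_pm[of n]]])
        (auto simp: Bn_partition_def)
    have "finite (pm n \<rightarrow>\<^sub>E insert 0 (signed U))"
      using U by (intro finite_PiE) (auto simp: finite_signed)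
    then show "\<forall>Q\<in>?N. finite (?F Q)" by simp
  qed auto
  also have "\<dots> = (\<Sum>Q\<in>?N. 2 ^ card U * fact (card U))"
    using card_odd_functions_ker_partition[OF _ _ U] by (intro sum.cong) auto
  also have "\<dots> = NB n P (card U) * (2 ^ card U * fact (card U))"
    by (simp add: NB_def)
  finally show ?thesis .
qed

text \<open>The functions are sorted by the set \<open>V\<close> of absolute values of their nonzero
  values; by oddness both signs of each member of \<open>V\<close> are attained.\<close>

lemma card_proper_odd_eq_sum:
  assumes U: "finite U" "U \<subseteq> {0<..}"
  shows "card (proper_odd n P U) =
    (\<Sum>V\<in>Pow U. card {f \<in> proper_odd n P V. signed V \<subseteq> f ` pm n})"
proof -
  let ?E = "\<lambda>V. {f \<in> proper_odd n P V. signed V \<subseteq> f ` pm n}"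
  have "proper_odd n P U = (\<Union>V\<in>Pow U. ?E V)"
  proof (intro equalityI subsetI)
    fix f assume f: "f \<in> proper_odd n P U"
    let ?V = "abs ` f ` pm n - {0}"
    have ran: "f x \<in> insert 0 (signed U)" if "x \<in> pm n" for x
      using f that by (auto simp: proper_odd_def PiE_iff)
    have odd: "f (- x) = - f x" if "x \<in> pm n" for x
      using f that by (auto simp: proper_odd_def)
    have "?V \<subseteq> U" using ran by (force simp: signed_def)
    moreover have "f \<in> proper_odd n P ?V"
      using f by (auto simp: proper_odd_def PiE_iff signed_def)
    moreover have "s \<in> f ` pm n" if "s \<in> signed ?V" for s
    proof -
      from that obtain x where x: "x \<in> pm n" "\<bar>s\<bar> = \<bar>f x\<bar>" by (auto simp: signed_def)
      then have "s = f x \<or> s = f (- x)" using odd by (auto simp: abs_eq_iff)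
      then show ?thesis using x by auto
    qed
    ultimately show "f \<in> (\<Union>V\<in>Pow U. ?E V)" by blast
  next
    fix f assume "f \<in> (\<Union>V\<in>Pow U. ?E V)"
    then obtain V where "V \<subseteq> U" "f \<in> proper_odd n P V" by auto
    then show "f \<in> proper_odd n P U"
      by (auto simp: proper_odd_def PiE_iff signed_def)
  qed
  also have "card \<dots> = (\<Sum>V\<in>Pow U. card (?E V))"
  proof (rule card_UN_disjoint)
    show "\<forall>V\<in>Pow U. finite (?E V)"
      using U by (auto intro!: finite_proper_odd intro: finite_subset)
    \<comment> \<open>The set \<open>V\<close> is recovered from \<open>f\<close>, so the classes
      are disjoint.\<close>
    have "V = abs ` f ` pm n - {0}" if "V \<subseteq> U" "f \<in> ?E V" for V f
    proof -
      have V: "V \<subseteq> {0<..}" using that U by auto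
      have "f ` pm n \<subseteq> insert 0 (signed V)" "signed V \<subseteq> f ` pm n"
        using that by (auto simp: proper_odd_def PiE_iff)
      then have "abs ` f ` pm n - {0} = abs ` signed V - {0}" by auto
      also have "\<dots> = V" using V by (auto simp: abs_image_signed)
      finally show ?thesis by simp
    qed
    then show "\<forall>V\<in>Pow U. \<forall>W\<in>Pow U. V \<noteq> W \<longrightarrow> ?E V \<inter> ?E W = {}"
      by (metis (no_types, lifting) IntE PowD equals0I)
  qed (use U in simp)
  finally show ?thesis .
qed

text \<open>Without surjectivity the count factors. On the zero-block, injectivity and oddness
  together mean nonzero values with distinct absolute values on the positive half. On one block of
  each pair any injective map into the \<open>2 * card U + 1\<close> labels is allowed, and the
  opposite block follows by oddness.\<close>

lemma card_proper_odd:
  fixes k :: nat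
  assumes P: "Bn_partition n P" and p: "bij_betw p {1..k} (block_pairs P)"
    and i: "\<And>\<alpha> B. \<alpha> \<in> {1..k} \<Longrightarrow> B \<in> p \<alpha> \<Longrightarrow> card B = i \<alpha>"
    and U: "finite U" "U \<subseteq> {0<..}"
  shows "card (proper_odd n P U) =
    2 ^ zero_half_size P * (fact (zero_half_size P) * (card U choose zero_half_size P)) *
    (\<Prod>\<alpha>=1..k. fact (i \<alpha>) * (Suc (2 * card U) choose i \<alpha>))"
proof -
  note part = Bn_partition_partition_on[OF P]
  define Z where "Z = \<Union>{B \<in> P. uminus ` B = B}"
  have "\<exists>B\<in>P. uminus ` B \<noteq> B \<and> p \<alpha> = {B, uminus ` B}" if "\<alpha> \<in> {1..k}" for \<alpha>
  proof -
    have "p \<alpha> \<in> block_pairs P" using bij_betwE[OF p] that by blast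
    then show ?thesis unfolding block_pairs_def by blast
  qed
  then obtain b where b: "\<And>\<alpha>. \<alpha> \<in> {1..k} \<Longrightarrow> b \<alpha> \<in> P"
    "\<And>\<alpha>. \<alpha> \<in> {1..k} \<Longrightarrow> uminus ` b \<alpha> \<noteq> b \<alpha>"
    "\<And>\<alpha>. \<alpha> \<in> {1..k} \<Longrightarrow> p \<alpha> = {b \<alpha>, uminus ` b \<alpha>}"
    by metis
  have PX: "x \<in> pm n" if "B \<in> P" "x \<in> B" for B x using that partition_onD1[OF part] by auto
  have uu: "uminus ` uminus ` B = B" for B :: "int set" by (simp add: image_image)
  have b_blk: "blk P x = b \<alpha>" "x \<in> pm n" if "\<alpha> \<in> {1..k}" "x \<in> b \<alpha>" for \<alpha> x
    using blk_eq[OF part b(1)[OF that(1)] that(2)] PX[OF b(1)[OF that(1)] that(2)] by auto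
  have b_uniq: "\<alpha> = \<beta>" if ab: "\<alpha> \<in> {1..k}" "\<beta> \<in> {1..k}" and "b \<alpha> = b \<beta> \<or> b \<alpha> = uminus ` b \<beta>" for \<alpha> \<beta>
  proof -
    have "p \<alpha> = p \<beta>" using that b(3) uu[of "b \<beta>"] by auto
    then show ?thesis using bij_betw_imp_inj_on[OF p] ab by (auto dest: inj_onD)
  qed
  have Z_iff: "x \<in> Z \<longleftrightarrow> x \<in> pm n \<and> blk P (- x) = blk P x" for x
  proof
    assume "x \<in> Z"
    then obtain B where B: "B \<in> P" "uminus ` B = B" "x \<in> B" unfolding Z_def by blast
    then have "x \<in> pm n" "blk P x = B" using PX blk_eq[OF part] by auto
    then show "x \<in> pm n \<and> blk P (- x) = blk P x" using Bn_blk_uminus[OF P] B(2) by simp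
  next
    assume "x \<in> pm n \<and> blk P (- x) = blk P x"
    then show "x \<in> Z" unfolding Z_def using blk_mem[OF part, of x] Bn_blk_uminus[OF P, of x] by auto
  qed
  have Z_neg: "- x \<in> Z \<longleftrightarrow> x \<in> Z" for x by (auto simp: Z_iff)
  have Z_b: False if "\<alpha> \<in> {1..k}" "x \<in> b \<alpha>" "x \<in> Z" for x \<alpha>
    using b_blk[OF that(1,2)] that(3) Z_iff[of x] Bn_blk_uminus[OF P, of x] b(2)[OF that(1)] by simp
  have b_neg: "blk P (- x) = uminus ` b \<alpha>" if "\<alpha> \<in> {1..k}" "x \<in> b \<alpha>" for x \<alpha>
    using b_blk[OF that] Bn_blk_uminus[OF P, of x] by simp
  have cover: "\<exists>\<alpha>\<in>{1..k}. x \<in> b \<alpha> \<or> - x \<in> b \<alpha>" if x: "x \<in> pm n" "x \<notin> Z" for x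
  proof -
    have "uminus ` blk P x \<noteq> blk P x" using x Z_iff Bn_blk_uminus[OF P] by auto
    then have "{blk P x, uminus ` blk P x} \<in> block_pairs P"
      unfolding block_pairs_def using blk_mem(1)[OF part x(1)] by blast
    then obtain \<alpha> where \<alpha>: "\<alpha> \<in> {1..k}" "p \<alpha> = {blk P x, uminus ` blk P x}"
      using bij_betw_imp_surj_on[OF p] by (metis imageE)
    then have "b \<alpha> = blk P x \<or> b \<alpha> = blk P (- x)"
      using b(3)[OF \<alpha>(1)] Bn_blk_uminus[OF P x(1)] by (auto simp: doubleton_eq_iff)
    then show ?thesis
      using \<alpha>(1) blk_mem(2)[OF part, of x] blk_mem(2)[OF part, of "- x"] x(1) by auto
  qed
  \<comment> \<open>Index 0 is reserved for the positive half of the zero-block, since the block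
    pairs are indexed from 1 to \<open>k\<close>.\<close>
  define A where "A \<alpha> = (if \<alpha> = 0 then {z \<in> Z. 0 < z} else b \<alpha>)" for \<alpha>
  define F where "F \<alpha> = (if \<alpha> = 0 then {g \<in> A 0 \<rightarrow>\<^sub>E signed U. inj_on (abs \<circ> g) (A 0)}
    else {g \<in> A \<alpha> \<rightarrow>\<^sub>E insert 0 (signed U). inj_on g (A \<alpha>)})" for \<alpha>
  define R where "R = (\<Union>\<alpha>\<in>{0..k}. A \<alpha>)"
  have K: "{0..k} = insert 0 {1..k}" by auto
  have A0: "x \<in> A 0 \<longleftrightarrow> x \<in> Z \<and> 0 < x" for x by (simp add: A_def)
  have A_b: "A \<alpha> = b \<alpha>" if "\<alpha> \<in> {1..k}" for \<alpha> using that by (simp add: A_def)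
  have R_iff: "x \<in> R \<longleftrightarrow> x \<in> Z \<and> 0 < x \<or> (\<exists>\<alpha>\<in>{1..k}. x \<in> b \<alpha>)" for x
    unfolding R_def K using A0 A_b by auto
  have Z_nz: "x \<noteq> 0" if "x \<in> Z" for x using that Z_iff[of x] by auto
  \<comment> \<open>Within \<open>Z\<close> only positive points are chosen. Outside
    \<open>Z\<close>, blocks chosen at \<open>x\<close> and at \<open>- x\<close> would be opposite,
    hence have the same index, and that block would be self-negative.\<close>
  have R_neg: "- x \<notin> R" if "x \<in> R" for x
  proof
    assume "- x \<in> R"
    have no_b: "\<forall>\<alpha>\<in>{1..k}. x \<notin> b \<alpha> \<and> - x \<notin> b \<alpha>" if "x \<in> Z" using that Z_b Z_neg by blast
    show False
    proof (cases "x \<in> Z")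
      case True
      then show False using no_b \<open>x \<in> R\<close> \<open>- x \<in> R\<close> R_iff by auto
    next
      case False
      then have "\<exists>\<alpha>\<in>{1..k}. x \<in> b \<alpha>" "\<exists>\<beta>\<in>{1..k}. - x \<in> b \<beta>"
        using \<open>x \<in> R\<close> \<open>- x \<in> R\<close> R_iff[of x] R_iff[of "- x"] Z_neg[of x] by simp_all
      then obtain \<alpha> \<beta> where ab: "\<alpha> \<in> {1..k}" "x \<in> b \<alpha>" "\<beta> \<in> {1..k}" "- x \<in> b \<beta>"
        by blast
      then have eq: "b \<beta> = uminus ` b \<alpha>" using b_blk(1)[OF ab(3,4)] b_neg[OF ab(1,2)] by simp
      then have "\<beta> = \<alpha>" using b_uniq ab by blast
      then show False using eq b(2) ab by auto
    qed
  qed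
  have "proper_odd n P U = {f \<in> pm n \<rightarrow>\<^sub>E insert 0 (signed U).
      (\<forall>x\<in>pm n. f (- x) = - f x) \<and> (\<forall>\<alpha>\<in>{0..k}. restrict f (A \<alpha>) \<in> F \<alpha>)}"
  proof -
    \<comment> \<open>Injectivity on all blocks reduces to the pieces: absolute values on the
      positive half of the zero-block, and plain values on one block of each pair.\<close>
    have "(\<forall>B\<in>P. inj_on f B) \<longleftrightarrow> (\<forall>\<alpha>\<in>{0..k}. restrict f (A \<alpha>) \<in> F \<alpha>)"
      if ran: "f \<in> pm n \<rightarrow>\<^sub>E insert 0 (signed U)" and odd: "\<forall>x\<in>pm n. f (- x) = - f x" for f
    proof
      assume inj: "\<forall>B\<in>P. inj_on f B"
      have inj': "x = y" if "x \<in> pm n" "y \<in> pm n" "blk P x = blk P y" "f x = f y" for x y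
        using inj that blk_mem[OF part] by (metis inj_onD)
      have "f x \<in> signed U" if "x \<in> A 0" for x
      proof -
        have x: "x \<in> pm n" "blk P (- x) = blk P x" "x \<noteq> 0" using that A0 Z_iff by auto
        then have "f (- x) \<noteq> f x" using inj'[of "- x" x] by auto
        then have "f x \<noteq> 0" using odd x(1) by auto
        then show ?thesis using ran x(1) by (auto simp: PiE_iff)
      qed
      moreover have "inj_on (abs \<circ> f) (A 0)"
      proof (rule inj_onI)
        fix x y assume xy: "x \<in> A 0" "y \<in> A 0" "(abs \<circ> f) x = (abs \<circ> f) y"
        then have X: "x \<in> pm n" "y \<in> pm n" "blk P (- x) = blk P x" "blk P (- y) = blk P y"
          and pos: "0 < x" "0 < y" using A0 Z_iff by auto
        then have "blk P x = blk P y" using Bn_zero_block_unique[OF P] by blast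
        moreover have "f x = f y \<or> f x = f (- y)" using xy(3) odd X(2) by (auto simp: abs_eq_iff)
        ultimately have "x = y \<or> x = - y" using inj'[of x y] inj'[of x "- y"] X by auto
        then show "x = y" using pos by auto
      qed
      ultimately have "restrict f (A 0) \<in> F 0" unfolding F_def by (auto simp: inj_on_def)
      moreover have "restrict f (A \<alpha>) \<in> F \<alpha>" if \<alpha>: "\<alpha> \<in> {1..k}" for \<alpha>
      proof -
        have "inj_on f (b \<alpha>)" using inj b(1)[OF \<alpha>] by blast
        moreover have "f x \<in> insert 0 (signed U)" if "x \<in> b \<alpha>" for x
          using ran b_blk(2)[OF \<alpha> that] by (auto simp: PiE_iff)
        ultimately show ?thesis using \<alpha> A_b[OF \<alpha>] unfolding F_def by (auto simp: inj_on_def)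
      qed
      ultimately show "\<forall>\<alpha>\<in>{0..k}. restrict f (A \<alpha>) \<in> F \<alpha>" unfolding K by blast
    next
      assume rf: "\<forall>\<alpha>\<in>{0..k}. restrict f (A \<alpha>) \<in> F \<alpha>"
      then have "restrict f (A 0) \<in> F 0" by auto
      then have f0: "f x \<in> signed U" "\<And>y. y \<in> A 0 \<Longrightarrow> \<bar>f x\<bar> = \<bar>f y\<bar> \<Longrightarrow> x = y" if "x \<in> A 0" for x
        using that unfolding F_def by (auto simp: inj_on_def)
      have inj_b: "inj_on f (b \<alpha>)" if \<alpha>: "\<alpha> \<in> {1..k}" for \<alpha>
      proof -
        have "restrict f (A \<alpha>) \<in> F \<alpha>" using rf \<alpha> by auto
        then show ?thesis using \<alpha> A_b[OF \<alpha>] unfolding F_def by (auto simp: inj_on_def)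
      qed
      show "\<forall>B\<in>P. inj_on f B"
      proof (intro ballI inj_onI)
        fix B x y assume B: "B \<in> P" "x \<in> B" "y \<in> B" and fxy: "f x = f y"
        have X: "x \<in> pm n" "y \<in> pm n" using PX B by auto
        have Bx: "blk P x = B" "blk P y = B" using blk_eq[OF part B(1)] B by auto
        show "x = y"
        proof (cases "x \<in> Z")
          case True
          then have y: "y \<in> Z" using Z_iff Bx X Bn_blk_uminus[OF P] by auto
          \<comment> \<open>Replacing \<open>z\<close> by its absolute value moves it into the
            positive half and, by oddness, changes the value of \<open>f\<close> at most by a
            sign.\<close>
          have abs_A0: "\<bar>z\<bar> \<in> A 0 \<and> \<bar>f \<bar>z\<bar>\<bar> = \<bar>f z\<bar>" if "z \<in> Z" for z
            using that Z_nz[OF that] Z_neg[of z] A0 odd Z_iff[of z] by (auto simp: abs_if)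
          then have "\<bar>x\<bar> = \<bar>y\<bar>" using f0(2)[of "\<bar>x\<bar>" "\<bar>y\<bar>"] True y fxy by simp
          \<comment> \<open>Equal values at opposite points would be 0, but \<open>f\<close> has
            nonzero labels on the positive half.\<close>
          moreover have "x \<noteq> - y"
          proof
            assume "x = - y"
            then have "f x = - f y" using odd X(2) by simp
            then have "f x = 0" using fxy by simp
            then have "f \<bar>x\<bar> = 0" using abs_A0[OF True] by simp
            then show False using f0(1)[of "\<bar>x\<bar>"] abs_A0[OF True] zero_notin_signed[OF U(2)] by simp
          qed
          ultimately show ?thesis by (auto simp: abs_eq_iff)
        next
          case False
          then obtain \<alpha> where \<alpha>: "\<alpha> \<in> {1..k}" "x \<in> b \<alpha> \<or> - x \<in> b \<alpha>" using cover X(1) by blast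
          from \<alpha>(2) show ?thesis
          proof
            assume "x \<in> b \<alpha>"
            then have "B = b \<alpha>" using b_blk(1)[OF \<alpha>(1)] Bx by simp
            then show ?thesis using inj_b[OF \<alpha>(1)] B fxy by (auto dest: inj_onD)
          next
            \<comment> \<open>Here \<open>B\<close> is the block opposite to the chosen one, and
              injectivity is transported by negation.\<close>
            assume "- x \<in> b \<alpha>"
            then have "b \<alpha> = uminus ` B"
              using b_blk(1)[OF \<alpha>(1)] Bn_blk_uminus[OF P X(1)] Bx by simp
            then have "- x \<in> b \<alpha>" "- y \<in> b \<alpha>" using B by auto
            moreover have "f (- x) = f (- y)" using odd X fxy by simp
            ultimately have "- x = - y" using inj_b[OF \<alpha>(1)] by (auto dest: inj_onD)
            then show ?thesis by simp
          qed
        qed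
      qed
    qed
    then show ?thesis unfolding proper_odd_def by blast
  qed
  also have "card \<dots> = (\<Prod>\<alpha>\<in>{0..k}. card (F \<alpha>))"
  proof (rule card_odd_functions[where R = R])
    show "disjoint_family_on A {0..k}"
      unfolding disjoint_family_on_def
    proof (intro ballI impI)
      have disj: "A \<alpha> \<inter> A \<beta> = {}" if "\<alpha> \<in> {0..k}" "\<beta> \<in> {1..k}" "\<alpha> \<noteq> \<beta>" for \<alpha> \<beta>
      proof (cases "\<alpha> = 0")
        case True
        then show ?thesis using Z_b[OF that(2)] A0 A_b[OF that(2)] by auto
      next
        case False
        then have \<alpha>: "\<alpha> \<in> {1..k}" using that by auto
        then have "b \<alpha> \<noteq> b \<beta>" using b_uniq that by blast
        then show ?thesis
          using b_blk(1)[OF \<alpha>] b_blk(1)[OF that(2)] A_b[OF \<alpha>] A_b[OF that(2)] by fastforce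
      qed
      fix \<alpha> \<beta> assume "\<alpha> \<in> {0..k}" "\<beta> \<in> {0..k}" "\<alpha> \<noteq> \<beta>"
      then show "A \<alpha> \<inter> A \<beta> = {}"
        using disj[of \<alpha> \<beta>] disj[of \<beta> \<alpha>] by (cases "\<beta> = 0") auto
    qed
    show "pm n = R \<union> uminus ` R"
    proof (intro equalityI subsetI)
      fix x assume x: "x \<in> pm n"
      have "x \<in> R \<or> - x \<in> R"
      proof (cases "x \<in> Z")
        case True
        then show ?thesis using Z_neg[of x] Z_nz[of x] R_iff[of x] R_iff[of "- x"] by auto
      next
        case False
        then show ?thesis using cover[OF x] R_iff by blast
      qed
      then show "x \<in> R \<union> uminus ` R" by (metis UnCI imageI minus_minus)
    next
      fix x assume "x \<in> R \<union> uminus ` R"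
      moreover have "y \<in> pm n" if "y \<in> R" for y
        using that R_iff[of y] Z_iff[of y] b_blk(2) by auto
      ultimately show "x \<in> pm n" by auto
    qed
    show "R \<inter> uminus ` R = {}" using R_neg by auto
    show "uminus ` insert 0 (signed U) \<subseteq> insert 0 (signed U)" by (auto simp: signed_def)
    show "F \<alpha> \<subseteq> A \<alpha> \<rightarrow>\<^sub>E insert 0 (signed U)" for \<alpha>
      unfolding F_def by (auto simp: PiE_iff extensional_def)
  qed (simp_all add: R_def)
  also have "\<dots> = card (F 0) * (\<Prod>\<alpha>=1..k. card (F \<alpha>))"
    unfolding K by (rule prod.insert) simp_all
  also have "card (F 0) =
      2 ^ zero_half_size P * (fact (zero_half_size P) * (card U choose zero_half_size P))"
  proof -
    have "Z \<subseteq> pm n" using Z_iff by auto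
    then have "finite (A 0)" using A0 by (metis finite_pm finite_subset subsetI)
    \<comment> \<open>The zero-block is closed under negation and omits 0, so its absolute values
      are its positive points; this is where the half-size enters.\<close>
    moreover have "A 0 = abs ` Z"
      using A0 Z_neg Z_nz by (force simp: abs_if image_iff split: if_splits)
    then have "card (A 0) = zero_half_size P" by (simp add: zero_half_size_def Z_def)
    ultimately show ?thesis using card_PiE_inj_on_abs[OF _ U, of "A 0"] by (simp add: F_def)
  qed
  also have "(\<Prod>\<alpha>=1..k. card (F \<alpha>)) = (\<Prod>\<alpha>=1..k. fact (i \<alpha>) * (Suc (2 * card U) choose i \<alpha>))"
  proof (rule prod.cong)
    fix \<alpha> assume \<alpha>: "\<alpha> \<in> {1..k}"
    have "finite (b \<alpha>)" using b_blk(2)[OF \<alpha>] by (metis finite_pm finite_subset subsetI)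
    moreover have "card (b \<alpha>) = i \<alpha>" using i[OF \<alpha>] b(3)[OF \<alpha>] by simp
    moreover have "card (insert 0 (signed U)) = Suc (2 * card U)"
      using finite_signed[OF U] zero_notin_signed[OF U(2)] card_signed[OF U] by simp
    moreover have "F \<alpha> = {g \<in> b \<alpha> \<rightarrow>\<^sub>E insert 0 (signed U). inj_on g (b \<alpha>)}"
      using \<alpha> A_b[OF \<alpha>] by (simp add: F_def)
    ultimately show "card (F \<alpha>) = fact (i \<alpha>) * (Suc (2 * card U) choose i \<alpha>)"
      using card_PiE_inj_on[of "b \<alpha>" "insert 0 (signed U)"] finite_signed[OF U] by simp
  qed simp
  finally show ?thesis .
qed

subsection \<open>Coefficients of the generating polynomial\<close>

lemma prod_single:
  fixes c :: "'b \<Rightarrow> 'c::comm_semiring_1" and e :: "'b \<Rightarrow> 'a::comm_monoid_add"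
  assumes "finite K"
  shows "(\<Prod>\<alpha>\<in>K. Poly_Mapping.single (e \<alpha>) (c \<alpha>)) = Poly_Mapping.single (\<Sum>\<alpha>\<in>K. e \<alpha>) (\<Prod>\<alpha>\<in>K. c \<alpha>)"
  using assms by (induction K rule: finite_induct) (auto simp: mult_single)

lemma single_power:
  fixes c :: "'c::comm_semiring_1" and e :: "'a::comm_monoid_add"
  shows "Poly_Mapping.single e c ^ j = Poly_Mapping.single (\<Sum>_\<in>{..<j}. e) (c ^ j)"
  using prod_single[of "{..<j}" "\<lambda>_. e" "\<lambda>_. c"] by simp

lemma sum_single_eq_iff:
  assumes "finite K"
  shows "(\<Sum>\<alpha>\<in>K. Poly_Mapping.single \<alpha> (a \<alpha>)) = (\<Sum>\<alpha>\<in>K. Poly_Mapping.single \<alpha> (b \<alpha>))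
    \<longleftrightarrow> (\<forall>\<alpha>\<in>K. a \<alpha> = (b \<alpha> :: nat))"
proof
  have *: "Poly_Mapping.lookup (\<Sum>\<alpha>\<in>K. Poly_Mapping.single \<alpha> (a \<alpha>)) \<beta> = a \<beta>"
    if "\<beta> \<in> K" for \<beta> and a :: "'a \<Rightarrow> nat"
    using assms that by (simp add: lookup_sum lookup_single when_def sum.delta)
  show "\<forall>\<alpha>\<in>K. a \<alpha> = b \<alpha>"
    if "(\<Sum>\<alpha>\<in>K. Poly_Mapping.single \<alpha> (a \<alpha>)) = (\<Sum>\<alpha>\<in>K. Poly_Mapping.single \<alpha> (b \<alpha>))"
    using * that by metis
qed simp

text \<open>The binomial theorem, put in a form with explicit \<open>single\<close> terms so that a
  product over the variables can be expanded monomial by monomial.\<close>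

lemma one_plus_Xvar_power:
  "(1 + Xvar \<alpha>) ^ N =
    (\<Sum>j\<le>N. Poly_Mapping.single (Poly_Mapping.single \<alpha> j) (of_nat (N choose j)))"
proof -
  have *: "(\<Sum>_<j. Poly_Mapping.single \<alpha> (1::nat)) = Poly_Mapping.single \<alpha> j" for j :: nat
    by (induction j) (simp_all add: single_add[symmetric] del: sum_constant)
  have "Xvar \<alpha> ^ j = Poly_Mapping.single (Poly_Mapping.single \<alpha> j) 1" for j
    by (simp only: Xvar_def single_power * power_one)
  then have "(Xvar \<alpha> + 1) ^ N =
      (\<Sum>j\<le>N. of_nat (N choose j) * Poly_Mapping.single (Poly_Mapping.single \<alpha> j) 1)"
    by (simp add: binomial_ring)
  moreover have "of_nat c * Poly_Mapping.single e 1 = Poly_Mapping.single e (of_nat c :: rat)"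
    for c and e :: "nat \<Rightarrow>\<^sub>0 nat"
    using mult_single[of 0 "of_nat c :: rat" e 1] by (simp only: single_of_nat add_0 mult_1_right)
  ultimately show ?thesis
    by (simp add: add.commute)
qed

text \<open>The product expands into a sum over functions \<open>h\<close> that choose an exponent
  for each variable. Distinct choices give distinct monomials, so only the choice that agrees with
  \<open>a\<close> contributes.\<close>

lemma mcoeff_prod_one_plus_Xvar:
  "mcoeff k a (\<Prod>\<alpha>=1..k. (1 + Xvar \<alpha>) ^ N) = (\<Prod>\<alpha>=1..k. of_nat (N choose a \<alpha>))"
proof -
  let ?a = "restrict a {1..k}"
  let ?G = "\<Sum>h\<in>{1..k} \<rightarrow>\<^sub>E {..N}. Poly_Mapping.single
      (\<Sum>\<alpha>=1..k. Poly_Mapping.single \<alpha> (h \<alpha>)) (\<Prod>\<alpha>=1..k. of_nat (N choose h \<alpha>) :: rat)"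
  have "mcoeff k a (\<Prod>\<alpha>=1..k. (1 + Xvar \<alpha>) ^ N) = mcoeff k a ?G"
    by (simp add: one_plus_Xvar_power prod_sum_PiE prod_single)
  also have "\<dots> = (\<Sum>h\<in>{1..k} \<rightarrow>\<^sub>E {..N}.
      if h = ?a then \<Prod>\<alpha>=1..k. of_nat (N choose a \<alpha>) else 0)"
    unfolding mcoeff_def lookup_sum
  proof (rule sum.cong)
    fix h assume h: "h \<in> {1..k} \<rightarrow>\<^sub>E {..N}"
    have "(\<forall>\<alpha>\<in>{1..k}. h \<alpha> = a \<alpha>) \<longleftrightarrow> h = ?a"
      using h by (intro iffI extensionalityI[of h "{1..k}"]) (auto simp: PiE_iff simp del: One_nat_def)
    then have eq: "(\<Sum>\<alpha>=1..k. Poly_Mapping.single \<alpha> (h \<alpha>)) = (\<Sum>\<alpha>=1..k. Poly_Mapping.single \<alpha> (a \<alpha>))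
        \<longleftrightarrow> h = ?a"
      by (simp only: sum_single_eq_iff finite_atLeastAtMost)
    have "(\<Prod>\<alpha>=1..k. of_nat (N choose h \<alpha>)) = (\<Prod>\<alpha>=1..k. of_nat (N choose a \<alpha>) :: rat)"
      if "h = ?a" using that by (intro prod.cong) simp_all
    then show "Poly_Mapping.lookup (Poly_Mapping.single
        (\<Sum>\<alpha>=1..k. Poly_Mapping.single \<alpha> (h \<alpha>)) (\<Prod>\<alpha>=1..k. of_nat (N choose h \<alpha>) :: rat))
        (\<Sum>\<alpha>=1..k. Poly_Mapping.single \<alpha> (a \<alpha>)) =
        (if h = ?a then \<Prod>\<alpha>=1..k. of_nat (N choose a \<alpha>) else 0)"
      unfolding lookup_single eq when_def by (intro if_cong refl) blast
  qed simp
  also have "\<dots> = (if ?a \<in> {1..k} \<rightarrow>\<^sub>E {..N} then \<Prod>\<alpha>=1..k. of_nat (N choose a \<alpha>) else 0)"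
    by (simp only: sum.delta finite_PiE finite_atMost finite_atLeastAtMost)
  \<comment> \<open>If some \<open>a \<alpha>\<close> exceeds \<open>N\<close>, no choice function
    matches, and the product vanishes as well.\<close>
  also have "\<dots> = (\<Prod>\<alpha>=1..k. of_nat (N choose a \<alpha>))"
  proof (cases "\<forall>\<alpha>\<in>{1..k}. a \<alpha> \<le> N")
    case False
    then obtain \<alpha> where "\<alpha> \<in> {1..k}" "N < a \<alpha>" by force
    then have "(\<Prod>\<alpha>=1..k. of_nat (N choose a \<alpha>)) = (0::rat)"
      by (intro prod_zero) (auto intro!: bexI[of _ \<alpha>])
    then show ?thesis by simp
  qed auto
  finally show ?thesis .
qed

text \<open>Pulls the signed integer coefficients of the binomial expansion out of the coefficient
  functional; the natural case goes by induction and the negative one by a change of sign.\<close>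

lemma mcoeff_of_int_mult: "mcoeff k a (of_int c * G) = of_int c * mcoeff k a G"
proof -
  have nat: "mcoeff k a (of_nat c * G) = of_nat c * mcoeff k a G" for c
    by (induction c) (auto simp: mcoeff_def distrib_right lookup_add)
  show ?thesis
  proof (cases c rule: int_cases2)
    case (nonneg m)
    then show ?thesis using nat by simp
  next
    case (nonpos m)
    then show ?thesis using nat[of m] by (simp add: mcoeff_def)
  qed
qed

text \<open>With \<open>?A\<close> the product of the squares, \<open>(?A - 1) ^ m * ?A ^ z\<close>
  is a signed combination of the powers \<open>?A ^ (j + z)\<close>, whose coefficients are products
  of binomials.\<close>

lemma mcoeff_formula:
  "mcoeff k a (((\<Prod>\<alpha>=1..k. (1 + Xvar \<alpha>) ^ 2) - 1) ^ m * (\<Prod>\<alpha>=1..k. (1 + Xvar \<alpha>) ^ (2 * z))) =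
    (\<Sum>j\<le>m. of_int ((-1) ^ (m - j) * int (m choose j)) *
      (\<Prod>\<alpha>=1..k. of_nat ((2 * (j + z)) choose a \<alpha>)))"
proof -
  let ?A = "\<Prod>\<alpha>=1..k. (1 + Xvar \<alpha>) ^ 2"
  have pow: "?A ^ u = (\<Prod>\<alpha>=1..k. (1 + Xvar \<alpha>) ^ (2 * u))" for u
    by (simp add: power_mult flip: prod_power_distrib)
  have "(?A - 1) ^ m = (\<Sum>j\<le>m. of_nat (m choose j) * ?A ^ j * (- 1) ^ (m - j))"
    using binomial_ring[of ?A "- 1" m] by simp
  then have "(?A - 1) ^ m * ?A ^ z =
      (\<Sum>j\<le>m. of_int ((-1) ^ (m - j) * int (m choose j)) * ?A ^ (j + z))"
    by (simp add: sum_distrib_right sum_distrib_left power_add mult_ac)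
  then have "mcoeff k a ((?A - 1) ^ m * ?A ^ z) =
      (\<Sum>j\<le>m. mcoeff k a (of_int ((-1) ^ (m - j) * int (m choose j)) * ?A ^ (j + z)))"
    by (simp only: mcoeff_def lookup_sum)
  then show ?thesis
    by (simp only: mcoeff_of_int_mult pow mcoeff_prod_one_plus_Xvar)
qed

text \<open>The sum over choices of exponents is a product of two-term sums, each collapsed by
  Pascal's rule. The assumption \<open>1 \<le> i \<alpha>\<close> makes
  \<open>i \<alpha> - 1\<close> a true predecessor; at 0 the two exponents would coincide.\<close>

lemma sum_mcoeff_formula:
  assumes "\<And>\<alpha>. \<alpha> \<in> {1..k} \<Longrightarrow> 1 \<le> i \<alpha>"
  shows "(\<Sum>i' \<in> (\<Pi>\<^sub>E \<alpha>\<in>{1..k}. {i \<alpha>, i \<alpha> - 1}). mcoeff k i'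
      (((\<Prod>\<alpha>=1..k. (1 + Xvar \<alpha>) ^ 2) - 1) ^ m * (\<Prod>\<alpha>=1..k. (1 + Xvar \<alpha>) ^ (2 * z)))) =
    (\<Sum>j\<le>m. of_int ((-1) ^ (m - j) * int (m choose j)) *
      (\<Prod>\<alpha>=1..k. of_nat ((2 * (j + z) + 1) choose i \<alpha>)))"
proof -
  have "(\<Sum>i' \<in> (\<Pi>\<^sub>E \<alpha>\<in>{1..k}. {i \<alpha>, i \<alpha> - 1}). \<Prod>\<alpha>=1..k. of_nat (N choose i' \<alpha>)) =
      (\<Prod>\<alpha>=1..k. of_nat ((N + 1) choose i \<alpha>) :: rat)" for N
  proof -
    have "(\<Sum>i' \<in> (\<Pi>\<^sub>E \<alpha>\<in>{1..k}. {i \<alpha>, i \<alpha> - 1}). \<Prod>\<alpha>=1..k. of_nat (N choose i' \<alpha>)) =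
        (\<Prod>\<alpha>=1..k. \<Sum>j\<in>{i \<alpha>, i \<alpha> - 1}. of_nat (N choose j) :: rat)"
      by (rule prod_sum_PiE[symmetric]) auto
    also have "\<dots> = (\<Prod>\<alpha>=1..k. of_nat ((N + 1) choose i \<alpha>))"
    proof (rule prod.cong)
      fix \<alpha> assume "\<alpha> \<in> {1..k}"
      then obtain q where "i \<alpha> = Suc q" using assms by (metis Suc_le_D One_nat_def)
      then show "(\<Sum>j\<in>{i \<alpha>, i \<alpha> - 1}. of_nat (N choose j)) = (of_nat ((N + 1) choose i \<alpha>) :: rat)"
        by simp
    qed simp
    finally show ?thesis .
  qed
  note * = this
  show ?thesis
    unfolding mcoeff_formula
    by (subst sum.swap) (simp only: * flip: sum_distrib_left)
qed

subsection \<open>Moebius inversion\<close>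

lemma sum_Pow_card:
  fixes c :: "nat \<Rightarrow> 'b::comm_semiring_1"
  assumes "finite U"
  shows "(\<Sum>V\<in>Pow U. c (card V)) = (\<Sum>t\<le>card U. of_nat (card U choose t) * c t)"
proof -
  have "(\<Sum>V\<in>Pow U. c (card V)) = (\<Sum>t\<le>card U. \<Sum>V\<in>{V \<in> Pow U. card V = t}. c (card V))"
    using assms by (intro sum.group[symmetric]) (auto intro: card_mono)
  also have "\<dots> = (\<Sum>t\<le>card U. of_nat (card U choose t) * c t)"
    using assms by (intro sum.cong) (simp_all add: n_subsets)
  finally show ?thesis .
qed

text \<open>Moebius inversion over the subsets of \<open>{1..int l}\<close>. The number of functions
  with labels from \<open>V\<close> depends on \<open>card V\<close> alone, so the subsets are
  collected by size.\<close>

lemma NB_alternating_sum: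
  fixes k :: nat
  assumes P: "Bn_partition n P" and p: "bij_betw p {1..k} (block_pairs P)"
    and i: "\<And>\<alpha> B. \<alpha> \<in> {1..k} \<Longrightarrow> B \<in> p \<alpha> \<Longrightarrow> card B = i \<alpha>"
  defines "z \<equiv> zero_half_size P"
  shows "int (NB n P l * (2 ^ l * fact l)) = (\<Sum>t\<le>l. int (l choose t) * ((- 1) ^ (l - t) *
    int (2 ^ z * (fact z * (t choose z)) *
      (\<Prod>\<alpha>=1..k. fact (i \<alpha>) * (Suc (2 * t) choose i \<alpha>)))))"
proof -
  let ?U = "{1..int l}"
  let ?f = "\<lambda>V. int (card {f \<in> proper_odd n P V. signed V \<subseteq> f ` pm n})"
  have U: "finite ?U" "?U \<subseteq> {0<..}" "card ?U = l" by auto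
  \<comment> \<open>Inversion is applied to \<open>?f\<close> and its own subset sums, which are
    then identified with the counts of proper odd functions.\<close>
  have "?f ?U = (\<Sum>V\<in>Pow ?U. (- 1) ^ (card ?U - card V) * sum ?f (Pow V))"
    using U(1) by (intro inclusion_exclusion_mobius) auto
  also have "\<dots> = (\<Sum>V\<in>Pow ?U. (- 1) ^ (l - card V) *
      int (2 ^ z * (fact z * (card V choose z)) *
        (\<Prod>\<alpha>=1..k. fact (i \<alpha>) * (Suc (2 * card V) choose i \<alpha>))))"
  proof (rule sum.cong)
    fix V assume "V \<in> Pow ?U"
    then have V: "finite V" "V \<subseteq> {0<..}" using U(2) by (auto intro: finite_subset)
    have "sum ?f (Pow V) = int (card (proper_odd n P V))"
      by (simp only: card_proper_odd_eq_sum[OF V] of_nat_sum)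
    then show "(- 1) ^ (card ?U - card V) * sum ?f (Pow V) = (- 1) ^ (l - card V) *
      int (2 ^ z * (fact z * (card V choose z)) *
        (\<Prod>\<alpha>=1..k. fact (i \<alpha>) * (Suc (2 * card V) choose i \<alpha>)))"
      by (simp only: card_proper_odd[OF P p i V] U(3) z_def)
  qed simp
  also note sum_Pow_card[OF U(1), of "\<lambda>t. (- 1) ^ (l - t) *
    int (2 ^ z * (fact z * (t choose z)) *
      (\<Prod>\<alpha>=1..k. fact (i \<alpha>) * (Suc (2 * t) choose i \<alpha>)))"]
  finally show ?thesis by (simp only: card_proper_odd_onto[OF P U(1,2)] U(3) of_nat_id)
qed

section \<open>Comparison of the two alternating sums\<close>

theorem theorem2p1:
  fixes n k l i0 :: nat
    and P :: "int set set"
    and p :: "nat \<Rightarrow> int set set"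
    and i :: "nat \<Rightarrow> nat"
  assumes "n \<ge> 1"
    and "Bn_partition n P"
    and "zero_half_size P = i0"
    and "k \<ge> 1"
    and "bij_betw p {1..k} (block_pairs P)"
    and "\<And>\<alpha> B. \<alpha> \<in> {1..k} \<Longrightarrow> B \<in> p \<alpha> \<Longrightarrow> card B = i \<alpha>"
    and "l \<ge> 1"
    and "l \<ge> i0"
  shows "(of_nat (NB n P l) :: rat) =
    of_nat (\<Prod>\<alpha>=1..k. fact (i \<alpha>)) / of_nat (double_fact (2 * l - 2 * i0)) *
    (\<Sum>i' \<in> (\<Pi>\<^sub>E \<alpha>\<in>{1..k}. {i \<alpha>, i \<alpha> - 1}).
       mcoeff k i'
         (((\<Prod>\<alpha>=1..k. (1 + Xvar \<alpha>) ^ 2) - 1) ^ (l - i0) *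
          (\<Prod>\<alpha>=1..k. (1 + Xvar \<alpha>) ^ (2 * i0))))"
proof -
  define m where "m = l - i0"
  have l: "l = m + i0" using assms(8) by (simp add: m_def)
  \<comment> \<open>Blocks are nonempty, so the sizes meet the condition for Pascal's rule.\<close>
  have i_pos: "1 \<le> i \<alpha>" if \<alpha>: "\<alpha> \<in> {1..k}" for \<alpha>
  proof -
    have "p \<alpha> \<in> block_pairs P" using bij_betwE[OF assms(5)] \<alpha> by blast
    then obtain B where B: "B \<in> P" "B \<in> p \<alpha>" unfolding block_pairs_def by blast
    have part: "partition_on (pm n) P" using assms(2) by (rule Bn_partition_partition_on)
    have "B \<subseteq> pm n" "B \<noteq> {}" using B(1) partition_onD1[OF part] partition_onD3[OF part] by auto
    then have "card B \<noteq> 0" using finite_subset[OF _ finite_pm] by auto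
    then show ?thesis using assms(6)[OF \<alpha> B(2)] by simp
  qed
  let ?Fac = "\<Prod>\<alpha>=1..k. fact (i \<alpha>) :: nat"
  let ?C = "\<lambda>j. \<Prod>\<alpha>=1..k. (2 * (j + i0) + 1) choose i \<alpha>"
  let ?S = "\<Sum>j\<le>m. (- 1) ^ (m - j) * int (m choose j) * int (?C j)"
  let ?c = "\<lambda>t. int (l choose t) * ((- 1) ^ (l - t) * int (2 ^ i0 * (fact i0 * (t choose i0)) *
      (\<Prod>\<alpha>=1..k. fact (i \<alpha>) * (Suc (2 * t) choose i \<alpha>))))"
  have "int (NB n P l * (2 ^ l * fact l)) = (\<Sum>t\<le>l. ?c t)"
    using NB_alternating_sum[OF assms(2,5,6)] by (simp only: assms(3))
  \<comment> \<open>Terms with \<open>t < i0\<close> vanish because \<open>t choose i0\<close> does;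
    the others are indexed by \<open>t = j + i0\<close>.\<close>
  also have "\<dots> = (\<Sum>t\<in>(\<lambda>j. j + i0) ` {..m}. ?c t)"
  proof (rule sum.mono_neutral_right)
    have "t \<in> (\<lambda>j. j + i0) ` {..m}" if "i0 \<le> t" "t \<le> l" for t
      using that l by (intro image_eqI[of _ _ "t - i0"]) auto
    then have "t < i0" if "t \<in> {..l} - (\<lambda>j. j + i0) ` {..m}" for t
      using that by (metis DiffE atMost_iff not_le_imp_less)
    then show "\<forall>t\<in>{..l} - (\<lambda>j. j + i0) ` {..m}. ?c t = 0"
      by (intro ballI) (simp only: binomial_eq_0 mult_zero_left mult_zero_right of_nat_0)
  qed (use l in auto)
  also have "\<dots> = (\<Sum>j\<le>m. ?c (j + i0))"
    by (simp add: sum.reindex inj_on_def)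
  also have "\<dots> = (\<Sum>j\<le>m. int ((l choose i0) * 2 ^ i0 * fact i0 * ?Fac) *
      ((- 1) ^ (m - j) * int (m choose j) * int (?C j)))"
  proof (rule sum.cong)
    fix j assume "j \<in> {..m}"
    \<comment> \<open>Rewriting the product of binomials isolates the factor
      \<open>l choose i0\<close>, which is independent of \<open>j\<close>.\<close>
    then have ch: "(l choose (j + i0)) * ((j + i0) choose i0) = (l choose i0) * (m choose j)"
      using choose_mult[of i0 "j + i0" l] l by simp
    have "?c (j + i0) = int ((l choose (j + i0)) * ((j + i0) choose i0)) *
        (int (2 ^ i0 * fact i0 * ?Fac) * ((- 1) ^ (m - j) * int (?C j)))"
      by (simp add: l prod.distrib mult_ac)
    then show "?c (j + i0) = int ((l choose i0) * 2 ^ i0 * fact i0 * ?Fac) *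
      ((- 1) ^ (m - j) * int (m choose j) * int (?C j))"
      unfolding ch by (simp add: mult_ac)
  qed simp
  also have "\<dots> = int ((l choose i0) * 2 ^ i0 * fact i0 * ?Fac) * ?S"
    by (simp only: sum_distrib_left)
  also have "int (NB n P l * (2 ^ l * fact l)) =
      int ((l choose i0) * 2 ^ i0 * fact i0) * (int (NB n P l) * int (2 ^ m * fact m))"
  proof -
    \<comment> \<open>Splitting \<open>fact l\<close> produces the same factor
      \<open>l choose i0\<close> on the left, so it cancels together with
      \<open>2 ^ i0 * fact i0\<close>.\<close>
    have "fact l = (fact i0 * fact m * (l choose i0) :: nat)"
      using binomial_fact_lemma[OF assms(8)] by (simp add: m_def)
    then show ?thesis by (simp add: l power_add mult_ac)
  qed
  finally have eq: "int ((l choose i0) * 2 ^ i0 * fact i0) * (int (NB n P l) * int (2 ^ m * fact m)) =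
      int ((l choose i0) * 2 ^ i0 * fact i0) * (int ?Fac * ?S)"
    by (simp add: mult_ac)
  have nz: "int ((l choose i0) * 2 ^ i0 * fact i0) \<noteq> 0" using assms(8) by simp
  have "int (NB n P l) * int (2 ^ m * fact m) = int ?Fac * ?S"
    using eq by (rule mult_left_cancel[OF nz, THEN iffD1])
  then have "rat_of_int (int (NB n P l) * int (2 ^ m * fact m)) = rat_of_int (int ?Fac * ?S)"
    by (rule arg_cong)
  then have "rat_of_nat (NB n P l) * rat_of_nat (2 ^ m * fact m) = rat_of_nat ?Fac * rat_of_int ?S"
    by (simp only: of_int_mult of_int_of_nat_eq)
  \<comment> \<open>What remains beside \<open>NB n P l\<close> after the cancellation is the double
    factorial in the denominator.\<close>
  moreover have "double_fact (2 * l - 2 * i0) = 2 ^ m * fact m"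
    using double_fact_even[of m] by (simp add: m_def diff_mult_distrib2)
  moreover have "rat_of_nat (2 ^ m * fact m) \<noteq> 0" by simp
  moreover have "rat_of_int ?S = (\<Sum>i' \<in> (\<Pi>\<^sub>E \<alpha>\<in>{1..k}. {i \<alpha>, i \<alpha> - 1}). mcoeff k i'
         (((\<Prod>\<alpha>=1..k. (1 + Xvar \<alpha>) ^ 2) - 1) ^ m * (\<Prod>\<alpha>=1..k. (1 + Xvar \<alpha>) ^ (2 * i0))))"
    by (subst sum_mcoeff_formula[OF i_pos])
      (simp_all only: of_int_sum of_int_mult of_int_of_nat_eq of_nat_prod of_int_prod)
  ultimately show ?thesis
    unfolding m_def[symmetric] by (simp add: nonzero_eq_divide_eq)
qed

end
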